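(* Let $0\le\alpha<d$ and $1\le p\le q<\infty$ be such that $\frac1p-\frac1q\le\frac{\alpha}{d}$, and let $(U,V)$ be a pair of $n\times n$ matrix weights on $\mathbb{R}^d$. The following are equivalent: (1) $(U,V)\in A_{p,q}^\alpha$, i.e. $[U,V]_{A_{p,q}^\alpha}<\infty$; (2) the operators $A_{\mathcal{Q}}^\alpha$ are bounded from $L^p(V)$ to $L^q(U)$ uniformly over all families $\mathcal{Q}$ of pairwise disjoint cubes in $\mathbb{R}^d$, with $$\|A_{\mathcal{Q}}^\alpha f\|_{L^q(U)}\le C\,[U,V]_{A_{p,q}^\alpha}\|f\|_{L^p(V)}\qquad\text{for all } f\in L^p(V),$$ where $C$ is independent of $\mathcal{Q}$ and depends only on $d,n,p,q,\alpha$ (and the right-hand constant is finite).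
   Context: Cubes $Q\subset\mathbb{R}^d$ have edges parallel to the coordinate axes; $p'$ is the conjugate exponent of $p$. A matrix weight is an $n\times n$ self-adjoint matrix function $U$ on $\mathbb{R}^d$ with locally integrable entries such that $U(x)$ is positive definite for a.e. $x$; powers $U^r$ are defined by diagonalization. $|\cdot|_{\mathrm{op}}$ is the operator norm. $L^p(U)$ is the set of measurable $f:\mathbb{R}^d\to\mathbb{C}^n$ with $\|f\|_{L^p(U)}=\big(\int|U^{1/p}f|^p\,dx\big)^{1/p}<\infty$. For $p>1$, $$[U,V]_{A_{p,q}^\alpha}=\sup_Q|Q|^{\frac{\alpha}{d}+\frac1q-\frac1p}\left(\frac1{|Q|}\int_Q\Big(\frac1{|Q|}\int_Q|U(x)^{\frac1q}V(y)^{-\frac1p}|_{\mathrm{op}}^{p'}\,dy\Big)^{\frac{q}{p'}}dx\right)^{\frac1q},$$ and for $p=1$, $$[U,V]_{A_{1,q}^\alpha}=\sup_Q|Q|^{\frac{\alpha}{d}+\frac1q-1}\operatorname*{ess\,sup}_{y\in Q}\left(\frac1{|Q|}\int_Q|U(x)^{\frac1q}V(y)^{-1}|_{\mathrm{op}}^{q}\,dx\right)^{\frac1q}.$$ For a cube $Q$, $A_Q^\alpha f(x)=|Q|^{\frac{\alpha}{d}}\frac1{|Q|}\int_Qf(y)\,dy\cdot\chi_Q(x)$, and for a family $\mathcal{Q}$ of disjoint cubes, $A_{\mathcal{Q}}^\alpha f(x)=\sum_{Q\in\mathcal{Q}}A_Q^\alpha f(x)$. *)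

theory Defs
  imports "HOL-Analysis.Analysis" "HOL-Probability.Essential_Supremum"
begin

section \<open>Complex matrices\<close>

definition adjoint_mat :: "complex^'n^'n \<Rightarrow> complex^'n^'n" where
  "adjoint_mat A = (\<chi> i j. cnj (A $ j $ i))"

definition self_adjoint_mat :: "complex^'n^'n \<Rightarrow> bool" where
  "self_adjoint_mat A \<longleftrightarrow> adjoint_mat A = A"

definition unitary_mat :: "complex^'n^'n \<Rightarrow> bool" where
  "unitary_mat P \<longleftrightarrow> adjoint_mat P ** P = mat 1 \<and> P ** adjoint_mat P = mat 1"

definition complex_inner :: "complex^'n \<Rightarrow> complex^'n \<Rightarrow> complex" where
  "complex_inner x y = (\<Sum>i\<in>UNIV. x $ i * cnj (y $ i))"

text \<open>For self-adjoint \<open>A\<close> the number \<open>complex_inner (A *v x) x\<close> is real, so taking the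
  real part loses nothing.\<close>

definition pos_def_mat :: "complex^'n^'n \<Rightarrow> bool" where
  "pos_def_mat A \<longleftrightarrow>
     self_adjoint_mat A \<and> (\<forall>x. x \<noteq> 0 \<longrightarrow> 0 < Re (complex_inner (A *v x) x))"

definition real_diag_mat :: "real^'n \<Rightarrow> complex^'n^'n" where
  "real_diag_mat l = (\<chi> i j. if i = j then complex_of_real (l $ i) else 0)"

lemma real_diag_mat_mult_left: "(real_diag_mat l ** W) $ i $ j = complex_of_real (l $ i) * W $ i $ j"
  by (simp add: real_diag_mat_def matrix_matrix_mult_def if_distrib[of "\<lambda>x. x * _"] cong: if_cong)

lemma real_diag_mat_mult_right: "(W ** real_diag_mat l) $ i $ j = W $ i $ j * complex_of_real (l $ j)"
  by (simp add: real_diag_mat_def matrix_matrix_mult_def if_distrib[of "\<lambda>x. _ * x"] cong: if_cong)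

text \<open>A function of a diagonalizable matrix does not depend on the chosen diagonalization.\<close>

lemma diagonalization_function_unique:
  assumes P: "unitary_mat P" and R: "unitary_mat R"
    and eq: "P ** real_diag_mat l ** adjoint_mat P = R ** real_diag_mat m ** adjoint_mat R"
  shows "P ** real_diag_mat (\<chi> i. f (l $ i)) ** adjoint_mat P =
         R ** real_diag_mat (\<chi> i. f (m $ i)) ** adjoint_mat R"
proof -
  define W where "W = adjoint_mat R ** P"
  have PP: "adjoint_mat P ** P = mat 1" "P ** adjoint_mat P = mat 1"
    and RR: "adjoint_mat R ** R = mat 1" "R ** adjoint_mat R = mat 1"
    using P R by (auto simp: unitary_mat_def)
  have "adjoint_mat R ** (P ** real_diag_mat l ** adjoint_mat P) ** P
      = adjoint_mat R ** (R ** real_diag_mat m ** adjoint_mat R) ** P"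
    using eq by simp
  then have "W ** real_diag_mat l ** (adjoint_mat P ** P)
      = (adjoint_mat R ** R) ** real_diag_mat m ** W"
    by (simp add: W_def matrix_mul_assoc)
  then have WW: "W ** real_diag_mat l = real_diag_mat m ** W"
    by (simp add: PP RR)
  have "W ** real_diag_mat (\<chi> i. f (l $ i)) = real_diag_mat (\<chi> i. f (m $ i)) ** W"
  proof -
    have "W $ i $ j * complex_of_real (f (l $ j)) = complex_of_real (f (m $ i)) * W $ i $ j" for i j
    proof (cases "W $ i $ j = 0")
      case False
      have "W $ i $ j * complex_of_real (l $ j) = complex_of_real (m $ i) * W $ i $ j"
        using WW by (metis real_diag_mat_mult_left real_diag_mat_mult_right)
      with False have "l $ j = m $ i" by simp
      then show ?thesis by simp
    qed simp
    then show ?thesis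
      by (simp add: vec_eq_iff real_diag_mat_mult_left real_diag_mat_mult_right)
  qed
  then have "R ** (W ** real_diag_mat (\<chi> i. f (l $ i))) ** adjoint_mat P
      = R ** (real_diag_mat (\<chi> i. f (m $ i)) ** W) ** adjoint_mat P"
    by simp
  then have "(R ** adjoint_mat R) ** P ** real_diag_mat (\<chi> i. f (l $ i)) ** adjoint_mat P
      = R ** real_diag_mat (\<chi> i. f (m $ i)) ** adjoint_mat R ** (P ** adjoint_mat P)"
    by (simp add: W_def matrix_mul_assoc)
  then show ?thesis by (simp add: PP RR)
qed

text \<open>By the previous lemma at most one \<open>B\<close> qualifies; one exists whenever \<open>A\<close> is self-adjoint.
  The value is only meaningful for positive definite \<open>A\<close>.\<close>

definition mat_powr :: "complex^'n^'n \<Rightarrow> real \<Rightarrow> complex^'n^'n" where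
  "mat_powr A r = (THE B. \<exists>P l. unitary_mat P \<and>
      A = P ** real_diag_mat l ** adjoint_mat P \<and>
      B = P ** real_diag_mat (\<chi> i. l $ i powr r) ** adjoint_mat P)"

lemma mat_powr_eqI:
  assumes "unitary_mat P" "A = P ** real_diag_mat l ** adjoint_mat P"
  shows "mat_powr A r = P ** real_diag_mat (\<chi> i. l $ i powr r) ** adjoint_mat P"
  unfolding mat_powr_def
proof (rule the_equality)
  fix B assume "\<exists>R m. unitary_mat R \<and> A = R ** real_diag_mat m ** adjoint_mat R \<and>
      B = R ** real_diag_mat (\<chi> i. m $ i powr r) ** adjoint_mat R"
  then obtain R m where R: "unitary_mat R" and A: "A = R ** real_diag_mat m ** adjoint_mat R"
    and B: "B = R ** real_diag_mat (\<chi> i. m $ i powr r) ** adjoint_mat R"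
    by blast
  show "B = P ** real_diag_mat (\<chi> i. l $ i powr r) ** adjoint_mat P"
    unfolding B using A assms(2)
    by (intro diagonalization_function_unique[OF R assms(1), of m l "\<lambda>t. t powr r"]) simp
qed (use assms in blast)

text \<open>As a real-linear map, \<open>(*v) A\<close> has the usual operator norm for the Hermitian norms.\<close>

definition op_norm :: "complex^'n^'n \<Rightarrow> real" where
  "op_norm A = onorm ((*v) A)"


section \<open>Matrix weights and weighted spaces\<close>

definition matrix_weight :: "(real^'d \<Rightarrow> complex^'n^'n) \<Rightarrow> bool" where
  "matrix_weight U \<longleftrightarrow>
     (\<forall>x. self_adjoint_mat (U x)) \<and>
     (\<forall>i j K. compact K \<longrightarrow> set_integrable lebesgue K (\<lambda>x. U x $ i $ j)) \<and>
     (AE x in lebesgue. pos_def_mat (U x))"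

text \<open>Real powers on \<open>[0, \<infinity>]\<close>, used for positive exponents only.\<close>

definition ennreal_powr :: "ennreal \<Rightarrow> real \<Rightarrow> ennreal" where
  "ennreal_powr x r = (if x = \<infinity> then \<infinity> else ennreal (enn2real x powr r))"

definition Lp_norm :: "real \<Rightarrow> (real^'d \<Rightarrow> complex^'n^'n) \<Rightarrow> (real^'d \<Rightarrow> complex^'n) \<Rightarrow> ennreal" where
  "Lp_norm p U f =
     ennreal_powr (\<integral>\<^sup>+x. ennreal (norm (mat_powr (U x) (1/p) *v f x) powr p) \<partial>lebesgue) (1/p)"

definition Lp_space :: "real \<Rightarrow> (real^'d \<Rightarrow> complex^'n^'n) \<Rightarrow> (real^'d \<Rightarrow> complex^'n) set" where
  "Lp_space p U = {f \<in> borel_measurable lebesgue. Lp_norm p U f < \<infinity>}"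


section \<open>Cubes and the two-weight characteristic\<close>

text \<open>Nondegenerate cubes with axis-parallel edges; each face may or may not belong to the cube,
  so open, closed and half-open cubes are all included.\<close>

definition cubes :: "(real^'d) set set" where
  "cubes = {Q. \<exists>a l I. 0 < l \<and>
     (\<forall>i. I i \<in> {{a $ i .. a $ i + l}, {a $ i ..< a $ i + l},
                   {a $ i <.. a $ i + l}, {a $ i <..< a $ i + l}}) \<and>
     Q = {x. \<forall>i. x $ i \<in> I i}}"

abbreviation vol :: "(real^'d) set \<Rightarrow> real" where
  "vol Q \<equiv> measure lebesgue Q"

definition avg :: "(real^'d) set \<Rightarrow> (real^'d \<Rightarrow> ennreal) \<Rightarrow> ennreal" where
  "avg Q g = ennreal (1 / vol Q) * (\<integral>\<^sup>+x\<in>Q. g x \<partial>lebesgue)"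

definition conj_exp :: "real \<Rightarrow> real" where
  "conj_exp p = p / (p - 1)"

definition A_char ::
  "real \<Rightarrow> real \<Rightarrow> real \<Rightarrow> (real^'d \<Rightarrow> complex^'n^'n) \<Rightarrow> (real^'d \<Rightarrow> complex^'n^'n) \<Rightarrow> ennreal" where
  "A_char \<alpha> p q U V =
    (if p = 1 then
       SUP Q\<in>cubes. ennreal (vol Q powr (\<alpha> / real CARD('d) + 1/q - 1)) *
         esssup (restrict_space lebesgue Q) (\<lambda>y.
           ennreal_powr
             (avg Q (\<lambda>x. ennreal (op_norm (mat_powr (U x) (1/q) ** mat_powr (V y) (-1)) powr q)))
             (1/q))
     else
       SUP Q\<in>cubes. ennreal (vol Q powr (\<alpha> / real CARD('d) + 1/q - 1/p)) *
         ennreal_powr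
           (avg Q (\<lambda>x. ennreal_powr
             (avg Q (\<lambda>y. ennreal
               (op_norm (mat_powr (U x) (1/q) ** mat_powr (V y) (-1/p)) powr conj_exp p)))
             (q / conj_exp p)))
           (1/q))"


section \<open>Averaging operators\<close>

definition avg_op :: "real \<Rightarrow> (real^'d) set \<Rightarrow> (real^'d \<Rightarrow> complex^'n) \<Rightarrow> real^'d \<Rightarrow> complex^'n" where
  "avg_op \<alpha> Q f x = (vol Q powr (\<alpha> / real CARD('d)) * (1 / vol Q) * indicator Q x) *\<^sub>R
     (LINT y:Q|lebesgue. f y)"

definition disjoint_cubes :: "(real^'d) set set \<Rightarrow> bool" where
  "disjoint_cubes F \<longleftrightarrow> F \<subseteq> cubes \<and> disjoint F"

text \<open>The family may be infinite, hence \<open>infsum\<close> instead of \<open>sum\<close>; for pairwise disjoint cubes at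
  most one term is nonzero at each point.\<close>

definition avg_family_op ::
  "real \<Rightarrow> (real^'d) set set \<Rightarrow> (real^'d \<Rightarrow> complex^'n) \<Rightarrow> real^'d \<Rightarrow> complex^'n" where
  "avg_family_op \<alpha> F f x = (\<Sum>\<^sub>\<infinity>Q\<in>F. avg_op \<alpha> Q f x)"

text \<open>The integrability clause says that the averaging operator is defined on all of the domain
  space; without it the Bochner integral of a nonintegrable function would silently be \<open>0\<close>.\<close>

definition avg_family_op_bounded ::
  "real \<Rightarrow> real \<Rightarrow> real \<Rightarrow> (real^'d \<Rightarrow> complex^'n^'n) \<Rightarrow> (real^'d \<Rightarrow> complex^'n^'n) \<Rightarrow>
   (real^'d) set set \<Rightarrow> ennreal \<Rightarrow> bool" where
  "avg_family_op_bounded \<alpha> p q U V F K \<longleftrightarrow>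
     (\<forall>f \<in> Lp_space p V.
        (\<forall>Q\<in>F. set_integrable lebesgue Q f) \<and>
        avg_family_op \<alpha> F f \<in> Lp_space q U \<and>
        Lp_norm q U (avg_family_op \<alpha> F f) \<le> K * Lp_norm p V f)"

end

theory Submission
  imports Defs
begin

text \<open>Write \<open>W = U\<^bsup>1/q\<^esup>\<close>, \<open>D = V\<^bsup>1/p\<^esup>\<close> and \<open>T = V\<^bsup>-1/p\<^esup>\<close>, and let \<open>p'\<close> be the conjugate exponent
  of \<open>p\<close>. Because the factor \<open>|Q|\<^bsup>\<alpha>/d-1\<^esup>\<close> of the averaging operator on a cube \<open>Q\<close> is, by \<open>1/p +
  1/p' = 1\<close>, also what remains of the powers of \<open>|Q|\<close> in the characteristic, the theorem compares,
  cube by cube, the mixed norm of the kernel \<open>|W(x) T(y)|\<close> over \<open>Q \<times> Q\<close> with the norm of the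
  operator taking \<open>f\<close> to the constant \<open>\<integral>\<^sub>Q f\<close>.

  The kernel bounds the operator: \<open>W(x) f(y) = (W(x) T(y)) (D(y) f(y))\<close>, and the Hoelder
  inequality in \<open>y\<close> (\<open>kernel_integral_le\<close>) or, for \<open>p = 1\<close>, Jensen's inequality and Tonelli's
  theorem (\<open>kernel_integral_le_1\<close>) give \<open>\<parallel>A\<^sub>Q f\<parallel>\<^sup>q \<le> [U,V]\<^sup>q \<parallel>f \<chi>\<^sub>Q\<parallel>\<^sup>q\<close>. As the cubes of a family
  are disjoint and \<open>q \<ge> p\<close>, these estimates add up to \<open>\<parallel>A f\<parallel>\<^sup>q \<le> [U,V]\<^sup>q \<parallel>f\<parallel>\<^sup>q\<close>, with constant one
  (\<open>avg_family_op_bounded_of_cubes\<close>).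

  Conversely, bounds for the families consisting of one cube suffice. The difficulty is that the
  test function that detects \<open>|T(y) W(x) z|\<close> by duality depends on \<open>x\<close>, while the hypothesis
  controls one test function at a time. The integrals \<open>\<integral>\<^sub>Q f\<close> of all normalised test functions
  form a bounded spanning set of vectors. A basis chosen from this set with almost maximal
  determinant represents all its elements with coefficients of modulus at most two
  (\<open>almost_extremal_basis\<close>). So the sum \<open>G(x)\<close> of \<open>2|W(x) w|\<close> over the basis vectors \<open>w\<close> dominates
  \<open>|W(x) \<integral>\<^sub>Q f|\<close> for all test functions simultaneously, and its \<open>L\<^sup>q\<close> norm is controlled by the
  hypothesis for finitely many of them (\<open>test_average_envelope\<close>). Duality at fixed \<open>x\<close>
  (\<open>dual_norm_le\<close>, \<open>dual_esssup_le\<close>) then bounds the inner norm of the kernel by a multiple of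
  \<open>G(x)\<close>.

  The analysis rests on the measurability of \<open>x \<mapsto> U(x)\<^sup>r\<close> (\<open>borel_measurable_mat_powr\<close>), which
  comes from the spectral theorem for Hermitian matrices and a compactness argument.\<close>

section \<open>Hermitian matrices\<close>

lemma bounded_linear_matrix_vector [simp]: "bounded_linear ((*v) (A :: complex^'n^'n))"
  using matrix_vector_mul_linear[of A] by (simp add: linear_conv_bounded_linear)

lemma norm_matrix_vector_le: "norm (A *v x) \<le> op_norm A * norm x"
  unfolding op_norm_def by (rule onorm) simp

lemma op_norm_le: "(\<And>x. norm (A *v x) \<le> b * norm x) \<Longrightarrow> op_norm A \<le> b"
  unfolding op_norm_def by (rule onorm_le)

lemma op_norm_nonneg [simp]: "0 \<le> op_norm A"
  unfolding op_norm_def by (rule onorm_pos_le) simp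

text \<open>A norm is a convex function, and convex functions on a finite-dimensional space are
  continuous.\<close>

lemma continuous_on_op_norm: "continuous_on S (op_norm :: complex^'n^'n \<Rightarrow> real)"
proof -
  have "convex_on UNIV (op_norm :: complex^'n^'n \<Rightarrow> real)"
  proof (rule convex_onI)
    fix t :: real and A B :: "complex^'n^'n"
    assume t: "0 < t" "t < 1"
    have eq: "(*v) (r *\<^sub>R C) = (\<lambda>x. r *\<^sub>R (C *v x))" for r and C :: "complex^'n^'n"
      by (simp add: fun_eq_iff vec_eq_iff matrix_vector_mult_def scaleR_sum_right)
    have "op_norm ((1 - t) *\<^sub>R A + t *\<^sub>R B)
        = onorm (\<lambda>x. (1 - t) *\<^sub>R (A *v x) + t *\<^sub>R (B *v x))"
      unfolding op_norm_def matrix_vector_mult_add_rdistrib eq ..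
    also have "\<dots> \<le> onorm (\<lambda>x. (1 - t) *\<^sub>R (A *v x)) + onorm (\<lambda>x. t *\<^sub>R (B *v x))"
      by (intro onorm_triangle bounded_linear_scaleR_right bounded_linear_compose[OF bounded_linear_scaleR_right]) simp_all
    also have "\<dots> = (1 - t) * op_norm A + t * op_norm B"
      using t by (simp add: onorm_scaleR op_norm_def)
    finally show "op_norm ((1 - t) *\<^sub>R A + t *\<^sub>R B) \<le> (1 - t) * op_norm A + t * op_norm B" .
  qed simp
  then have "continuous_on UNIV (op_norm :: complex^'n^'n \<Rightarrow> real)"
    by (intro convex_on_continuous) auto
  then show ?thesis by (rule continuous_on_subset) simp
qed

lemma inner_eq_Re_complex_inner: "x \<bullet> y = Re (complex_inner x y)"
  by (simp add: inner_vec_def complex_inner_def inner_complex_def)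

lemma complex_inner_matrix_left:
  "complex_inner (A *v x) y = complex_inner x (adjoint_mat A *v y)"
proof -
  have "complex_inner (A *v x) y = (\<Sum>i\<in>UNIV. \<Sum>j\<in>UNIV. A$i$j * x$j * cnj (y$i))"
    by (simp add: complex_inner_def matrix_vector_mult_def sum_distrib_right)
  also have "\<dots> = (\<Sum>j\<in>UNIV. \<Sum>i\<in>UNIV. A$i$j * x$j * cnj (y$i))"
    by (rule sum.swap)
  also have "\<dots> = complex_inner x (adjoint_mat A *v y)"
    by (simp add: complex_inner_def matrix_vector_mult_def adjoint_mat_def sum_distrib_left mult_ac)
  finally show ?thesis .
qed

lemma complex_inner_self_adjoint:
  "self_adjoint_mat A \<Longrightarrow> complex_inner (A *v x) y = complex_inner x (A *v y)"
  by (simp add: complex_inner_matrix_left self_adjoint_mat_def)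

lemma inner_self_adjoint:
  "self_adjoint_mat A \<Longrightarrow> (A *v x) \<bullet> y = x \<bullet> (A *v y)"
  by (simp add: inner_eq_Re_complex_inner complex_inner_self_adjoint)

lemma complex_inner_cnj: "cnj (complex_inner x y) = complex_inner y x"
  by (simp add: complex_inner_def mult.commute)

lemma complex_inner_add_left: "complex_inner (x + y) z = complex_inner x z + complex_inner y z"
  by (simp add: complex_inner_def distrib_right sum.distrib)

lemma complex_inner_scale_left: "complex_inner (c *s x) z = c * complex_inner x z"
  by (simp add: complex_inner_def sum_distrib_left mult_ac)

lemma complex_inner_scale_right: "complex_inner x (c *s z) = cnj c * complex_inner x z"
  by (simp add: complex_inner_def sum_distrib_left mult_ac)

lemma complex_inner_scaleR_left: "complex_inner (c *\<^sub>R x) z = c *\<^sub>R complex_inner x z"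
  by (simp add: complex_inner_def scaleR_sum_right)

lemma complex_inner_self: "complex_inner x x = complex_of_real ((norm x)\<^sup>2)"
proof -
  have "Im (complex_inner x x) = 0"
    by (simp add: complex_inner_def mult.commute)
  moreover have "Re (complex_inner x x) = (norm x)\<^sup>2"
    by (metis inner_eq_Re_complex_inner power2_norm_eq_inner)
  ultimately show ?thesis by (simp add: complex_eq_iff)
qed

lemma continuous_on_complex_inner_left: "continuous_on S (\<lambda>x. complex_inner x y)"
  unfolding complex_inner_def by (intro continuous_intros)

lemma norm_vector_scale: "norm (c *s (v :: complex^'n)) = norm c * norm v"
  by (simp add: norm_vec_def norm_mult L2_set_right_distrib)

text \<open>Taking adjoints moves both factors onto fixed vectors, which is how duality for one vector
  at a time controls the operator norm.\<close>

lemma op_norm_le_sum_Basis: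
  fixes A B :: "complex^'n^'n"
  assumes "self_adjoint_mat A" "self_adjoint_mat B"
  shows "op_norm (A ** B) \<le> (\<Sum>b\<in>Basis. norm (B *v (A *v b)))"
proof (rule op_norm_le)
  fix u :: "complex^'n"
  have "norm ((A ** B) *v u) \<le> (\<Sum>b\<in>Basis. \<bar>((A ** B) *v u) \<bullet> b\<bar>)"
    by (rule norm_le_l1)
  also have "\<dots> = (\<Sum>b\<in>Basis. \<bar>u \<bullet> (B *v (A *v b))\<bar>)"
    by (simp add: matrix_vector_mul_assoc[symmetric] inner_self_adjoint assms)
  also have "\<dots> \<le> (\<Sum>b\<in>Basis. norm (B *v (A *v b)) * norm u)"
    by (intro sum_mono) (metis Cauchy_Schwarz_ineq2 mult.commute)
  finally show "norm ((A ** B) *v u) \<le> (\<Sum>b\<in>Basis. norm (B *v (A *v b))) * norm u"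
    by (simp add: sum_distrib_right)
qed

text \<open>A maximiser of the Rayleigh quotient on the unit sphere of an invariant subspace is
  stationary, hence an eigenvector.\<close>

lemma rayleigh_maximizer_eigenvector:
  fixes A :: "complex^'n^'n"
  assumes sa: "self_adjoint_mat A"
    and add: "\<And>x y. x \<in> W \<Longrightarrow> y \<in> W \<Longrightarrow> x + y \<in> W"
    and scale: "\<And>c x. x \<in> W \<Longrightarrow> c *\<^sub>R x \<in> W"
    and inv: "\<And>x. x \<in> W \<Longrightarrow> A *v x \<in> W"
    and u: "u \<in> W" "norm u = 1"
    and max: "\<And>x. x \<in> W \<Longrightarrow> norm x = 1 \<Longrightarrow> (A *v x) \<bullet> x \<le> (A *v u) \<bullet> u"
  shows "A *v u = ((A *v u) \<bullet> u) *\<^sub>R u"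
proof -
  define l where "l = (A *v u) \<bullet> u"
  define g where "g = A *v u - l *\<^sub>R u"
  have gW: "g \<in> W"
    using add[OF inv[OF u(1)] scale[OF u(1), of "- l"]] by (simp add: g_def)
  have quad: "(A *v v) \<bullet> v \<le> l * (v \<bullet> v)" if "v \<in> W" for v
  proof (cases "v = 0")
    case False
    have "(A *v (v /\<^sub>R norm v)) \<bullet> (v /\<^sub>R norm v) \<le> l"
      unfolding l_def using False that by (intro max scale) auto
    moreover have "A *v (v /\<^sub>R norm v) = (A *v v) /\<^sub>R norm v"
      by (rule linear_scale[OF matrix_vector_mul_linear])
    ultimately have "((A *v v) \<bullet> v) / (norm v)\<^sup>2 \<le> l"
      by (simp add: power2_eq_square divide_inverse mult_ac)
    then show ?thesis using False
      by (simp add: power2_norm_eq_inner[symmetric] field_simps)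
  qed simp
  have uu: "u \<bullet> u = 1" using u(2) by (simp add: norm_eq_1)
  have ug: "u \<bullet> g = 0"
    by (simp add: g_def inner_diff_right uu l_def inner_commute)
  have Aug: "(A *v u) \<bullet> g = g \<bullet> g"
  proof -
    have "A *v u = g + l *\<^sub>R u" by (simp add: g_def)
    then show ?thesis by (simp add: inner_add_left ug)
  qed
  \<comment> \<open>Maximality of \<open>u\<close> along the line \<open>u + t g\<close>: the linear term has to vanish.\<close>
  have key: "2 * t * (g \<bullet> g) \<le> t\<^sup>2 * (l * (g \<bullet> g) - (A *v g) \<bullet> g)" for t :: real
  proof -
    have lin: "A *v (u + t *\<^sub>R g) = A *v u + t *\<^sub>R (A *v g)"
      by (simp add: linear_add[OF matrix_vector_mul_linear] linear_scale[OF matrix_vector_mul_linear])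
    have Agu: "(A *v g) \<bullet> u = g \<bullet> g"
      using Aug inner_self_adjoint[OF sa, of g u] by (simp add: inner_commute)
    have ub: "(A *v (u + t *\<^sub>R g)) \<bullet> (u + t *\<^sub>R g) \<le> l * ((u + t *\<^sub>R g) \<bullet> (u + t *\<^sub>R g))"
      using add[OF u(1) scale[OF gW]] by (rule quad)
    have lhs: "(A *v (u + t *\<^sub>R g)) \<bullet> (u + t *\<^sub>R g) = l + 2 * t * (g \<bullet> g) + t\<^sup>2 * ((A *v g) \<bullet> g)"
      unfolding lin by (simp add: inner_add_left inner_add_right Aug Agu l_def[symmetric]
          power2_eq_square algebra_simps)
    have rhs: "(u + t *\<^sub>R g) \<bullet> (u + t *\<^sub>R g) = 1 + t\<^sup>2 * (g \<bullet> g)"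
      by (simp add: inner_add_left inner_add_right uu ug inner_commute[of g u] power2_eq_square)
    show ?thesis using ub unfolding lhs rhs by (simp add: algebra_simps)
  qed
  have "g \<bullet> g = 0"
  proof (rule ccontr)
    assume "g \<bullet> g \<noteq> 0"
    then have a: "0 < g \<bullet> g" by simp
    define b where "b = l * (g \<bullet> g) - (A *v g) \<bullet> g"
    \<comment> \<open>So small that the quadratic term cannot compensate the linear one.\<close>
    define t where "t = (g \<bullet> g) / (\<bar>b\<bar> + 1)"
    have t: "0 < t" using a by (simp add: t_def add_pos_nonneg)
    have "t * (2 * (g \<bullet> g)) \<le> t * (t * b)"
      using key[of t] by (simp add: b_def power2_eq_square mult_ac)
    then have "2 * (g \<bullet> g) \<le> t * b" using t by simp
    also have "t * b \<le> t * (\<bar>b\<bar> + 1)" using t by (intro mult_left_mono) auto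
    also have "\<dots> = g \<bullet> g" by (simp add: t_def)
    finally show False using a by simp
  qed
  then show ?thesis by (simp add: g_def l_def)
qed

text \<open>The eigenvectors are indexed by the coordinates of the space, so that those for the whole
  index type are the columns of a unitary matrix. A further eigenvector is a Rayleigh maximiser on
  the orthogonal complement of those already found.\<close>

lemma orthonormal_eigenvectors:
  fixes A :: "complex^'n^'n"
  assumes sa: "self_adjoint_mat A"
  shows "\<exists>(v :: 'n \<Rightarrow> complex^'n) l. (\<forall>i\<in>K. \<forall>j\<in>K. complex_inner (v i) (v j) = (if i = j then 1 else 0)) \<and>
      (\<forall>i\<in>K. A *v v i = complex_of_real (l i) *s v i)"
  using finite[of K]
proof (induction K rule: finite_induct)
  case empty
  then show ?case by simp
next
  case (insert k K)
  then obtain v :: "'n \<Rightarrow> complex^'n" and l where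
      orth: "\<And>i j. i\<in>K \<Longrightarrow> j\<in>K \<Longrightarrow> complex_inner (v i) (v j) = (if i = j then 1 else 0)"
      and eig: "\<And>i. i\<in>K \<Longrightarrow> A *v v i = complex_of_real (l i) *s v i"
    by blast
  define W where "W = {x. \<forall>j\<in>K. complex_inner x (v j) = 0}"
  have add: "x + y \<in> W" if "x \<in> W" "y \<in> W" for x y
    using that by (simp add: W_def complex_inner_add_left)
  have scale: "c *\<^sub>R x \<in> W" if "x \<in> W" for x and c :: real
    using that by (simp add: W_def complex_inner_scaleR_left)
  have inv: "A *v x \<in> W" if "x \<in> W" for x
    using that by (simp add: W_def complex_inner_self_adjoint[OF sa] eig complex_inner_scale_right)
  \<comment> \<open>The orthogonality conditions form a square system with a zero row, so it has a nonzero solution.\<close>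
  obtain x0 where x0: "x0 \<in> W" "x0 \<noteq> 0"
  proof -
    define M :: "complex^'n^'n" where "M = (\<chi> i j. if i \<in> K then cnj (v i $ j) else 0)"
    have Mx: "(M *v x) $ i = (if i \<in> K then complex_inner x (v i) else 0)" for x i
      by (simp add: M_def matrix_vector_mult_def complex_inner_def mult.commute)
    have "\<not> (\<exists>B. B ** M = mat 1)"
    proof
      assume "\<exists>B. B ** M = mat 1"
      then obtain B where "M ** B = mat 1" using matrix_left_right_inverse by metis
      then have "(M ** B) $ k $ k = 1" by (simp add: mat_def)
      moreover have "(M ** B) $ k $ k = 0"
        using insert.hyps by (simp add: matrix_matrix_mult_def M_def)
      ultimately show False by simp
    qed
    then obtain x where "M *v x = 0" "x \<noteq> 0"
      by (auto simp: matrix_left_invertible_ker)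
    moreover from this have "x \<in> W"
      unfolding W_def using Mx[of x] by (auto simp: vec_eq_iff split: if_splits)
    ultimately show ?thesis using that by blast
  qed
  have "closed W"
  proof -
    have "W = (\<Inter>j\<in>K. {x. complex_inner x (v j) = 0})" by (auto simp: W_def)
    also have "closed \<dots>"
      by (intro closed_INT ballI closed_Collect_eq continuous_on_complex_inner_left continuous_intros)
    finally show ?thesis .
  qed
  then have "compact (sphere 0 1 \<inter> W)" by (intro compact_Int_closed) auto
  moreover have "x0 /\<^sub>R norm x0 \<in> sphere 0 1 \<inter> W" using x0 scale by auto
  moreover have "continuous_on (sphere 0 1 \<inter> W) (\<lambda>x. (A *v x) \<bullet> x)"
    by (intro continuous_intros linear_continuous_on bounded_linear_matrix_vector)
  ultimately obtain u where u: "u \<in> sphere 0 1 \<inter> W"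
    and max: "\<And>x. x \<in> sphere 0 1 \<inter> W \<Longrightarrow> (A *v x) \<bullet> x \<le> (A *v u) \<bullet> u"
    using continuous_attains_sup[of "sphere 0 1 \<inter> W" "\<lambda>x. (A *v x) \<bullet> x"] by blast
  define m where "m = (A *v u) \<bullet> u"
  have Au: "A *v u = m *\<^sub>R u"
    unfolding m_def using u max by (intro rayleigh_maximizer_eigenvector[OF sa add scale inv]) auto
  have uv: "complex_inner u (v j) = 0" "complex_inner (v j) u = 0" if "j \<in> K" for j
  proof -
    show *: "complex_inner u (v j) = 0" using u that by (simp add: W_def)
    then show "complex_inner (v j) u = 0" by (metis complex_inner_cnj complex_cnj_zero)
  qed
  have uu: "complex_inner u u = 1" using u by (simp add: complex_inner_self)
  have sc: "m *\<^sub>R u = complex_of_real m *s u"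
    by (simp add: vec_eq_iff complex_eq_iff)
  show ?case
    using insert.hyps(2)
    by (intro exI[of _ "v(k := u)"] exI[of _ "l(k := m)"])
       (auto simp: orth eig uv uu Au sc)
qed

theorem pos_def_diagonalization:
  fixes A :: "complex^'n^'n"
  assumes "pos_def_mat A"
  obtains P l where "unitary_mat P" "A = P ** real_diag_mat l ** adjoint_mat P" "\<And>i. 0 < l $ i"
proof -
  have sa: "self_adjoint_mat A" using assms by (simp add: pos_def_mat_def)
  obtain v :: "'n \<Rightarrow> complex^'n" and l where
      orth: "\<And>i j. complex_inner (v i) (v j) = (if i = j then 1 else 0)"
      and eig: "\<And>i. A *v v i = complex_of_real (l i) *s v i"
    using orthonormal_eigenvectors[OF sa, of UNIV] by auto
  define P :: "complex^'n^'n" where "P = (\<chi> i j. v j $ i)"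
  have "adjoint_mat P ** P = mat 1"
  proof -
    have "(adjoint_mat P ** P) $ i $ j = complex_inner (v j) (v i)" for i j
      by (simp add: adjoint_mat_def P_def matrix_matrix_mult_def complex_inner_def mult.commute)
    then show ?thesis by (auto simp: vec_eq_iff orth mat_def)
  qed
  then have U: "adjoint_mat P ** P = mat 1" "P ** adjoint_mat P = mat 1"
    using matrix_left_right_inverse by metis+
  have "A ** P = P ** real_diag_mat (\<chi> i. l i)"
  proof -
    have "(A ** P) $ i $ j = (A *v v j) $ i" for i j
      by (simp add: matrix_matrix_mult_def matrix_vector_mult_def P_def)
    then show ?thesis
      by (simp add: vec_eq_iff real_diag_mat_mult_right eig P_def mult.commute)
  qed
  then have "A ** P ** adjoint_mat P = P ** real_diag_mat (\<chi> i. l i) ** adjoint_mat P" by simp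
  then have "A = P ** real_diag_mat (\<chi> i. l i) ** adjoint_mat P"
    by (simp add: matrix_mul_assoc[symmetric] U)
  moreover have "0 < l i" for i
  proof -
    have "v i \<noteq> 0" using orth[of i i] by (auto simp: complex_inner_def)
    then have "0 < Re (complex_inner (A *v v i) (v i))" using assms by (simp add: pos_def_mat_def)
    then show ?thesis by (simp add: eig complex_inner_scale_left orth)
  qed
  ultimately show ?thesis using U by (intro that[of P "\<chi> i. l i"]) (auto simp: unitary_mat_def)
qed

lemma adjoint_mat_mult: "adjoint_mat (A ** B) = adjoint_mat B ** adjoint_mat A"
  by (simp add: adjoint_mat_def matrix_matrix_mult_def vec_eq_iff mult.commute)

lemma adjoint_mat_adjoint [simp]: "adjoint_mat (adjoint_mat A) = A"
  by (simp add: adjoint_mat_def vec_eq_iff)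

lemma adjoint_real_diag [simp]: "adjoint_mat (real_diag_mat l) = real_diag_mat l"
  by (simp add: adjoint_mat_def real_diag_mat_def vec_eq_iff)

lemma self_adjoint_mat_powr:
  assumes "pos_def_mat A" shows "self_adjoint_mat (mat_powr A r)"
proof -
  obtain P l where "unitary_mat P" "A = P ** real_diag_mat l ** adjoint_mat P"
    using pos_def_diagonalization[OF assms] by metis
  then have "mat_powr A r = P ** real_diag_mat (\<chi> i. l $ i powr r) ** adjoint_mat P"
    by (rule mat_powr_eqI)
  then show ?thesis by (simp add: self_adjoint_mat_def adjoint_mat_mult matrix_mul_assoc)
qed

lemma mat_powr_mult_minus:
  assumes "pos_def_mat A" shows "mat_powr A r ** mat_powr A (- r) = mat 1"
proof -
  obtain P l where U: "unitary_mat P" and A: "A = P ** real_diag_mat l ** adjoint_mat P"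
    and l: "\<And>i. 0 < l $ i"
    using pos_def_diagonalization[OF assms] by metis
  have PP: "adjoint_mat P ** P = mat 1" "P ** adjoint_mat P = mat 1"
    using U by (auto simp: unitary_mat_def)
  have ll: "real_diag_mat (\<chi> i. l $ i powr r) ** real_diag_mat (\<chi> i. l $ i powr (- r)) = mat 1"
  proof -
    have "l $ i powr r \<noteq> 0" for i using l[of i] by auto
    then show ?thesis
      by (auto simp: vec_eq_iff real_diag_mat_mult_left) (auto simp: real_diag_mat_def mat_def powr_minus)
  qed
  have "mat_powr A r ** mat_powr A (- r)
      = P ** real_diag_mat (\<chi> i. l $ i powr r) ** (adjoint_mat P ** P) **
         real_diag_mat (\<chi> i. l $ i powr (- r)) ** adjoint_mat P"
    unfolding mat_powr_eqI[OF U A] by (simp add: matrix_mul_assoc)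
  also have "\<dots> = P ** (real_diag_mat (\<chi> i. l $ i powr r) ** real_diag_mat (\<chi> i. l $ i powr (- r)))
      ** adjoint_mat P"
    by (simp add: PP matrix_mul_assoc)
  finally show ?thesis by (simp add: ll PP)
qed

section \<open>Powers and the Hoelder inequality for nonnegative integrals\<close>

lemma ennreal_powr_ennreal: "0 \<le> x \<Longrightarrow> ennreal_powr (ennreal x) r = ennreal (x powr r)"
  by (simp add: ennreal_powr_def)

lemma ennreal_powr_top [simp]: "ennreal_powr top r = top"
  by (simp add: ennreal_powr_def)

lemma ennreal_powr_0 [simp]: "ennreal_powr 0 r = 0"
  by (simp add: ennreal_powr_def)

lemma ennreal_powr_eq_0_iff [simp]: "ennreal_powr x r = 0 \<longleftrightarrow> x = 0"
  by (cases x) (auto simp: ennreal_powr_ennreal)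

lemma ennreal_powr_eq_top_iff [simp]: "ennreal_powr x r = top \<longleftrightarrow> x = top"
  by (cases x) (auto simp: ennreal_powr_ennreal)

lemma ennreal_powr_one [simp]: "ennreal_powr x 1 = x"
  by (cases x) (auto simp: ennreal_powr_ennreal)

lemma ennreal_powr_mono: "0 \<le> r \<Longrightarrow> x \<le> y \<Longrightarrow> ennreal_powr x r \<le> ennreal_powr y r"
  by (cases x; cases y) (auto simp: ennreal_powr_ennreal powr_mono2 top_unique)

lemma ennreal_powr_mult: "ennreal_powr (x * y) r = ennreal_powr x r * ennreal_powr y r"
proof (cases "x = 0 \<or> y = 0")
  case False
  then show ?thesis
    by (cases x; cases y)
       (auto simp: ennreal_powr_ennreal ennreal_mult[symmetric] powr_mult ennreal_mult_top ennreal_top_mult)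
qed auto

lemma ennreal_powr_powr: "ennreal_powr (ennreal_powr x r) s = ennreal_powr x (r * s)"
  by (cases x) (auto simp: ennreal_powr_ennreal powr_powr)

lemma ennreal_powr_add: "ennreal_powr x r * ennreal_powr x s = ennreal_powr x (r + s)"
  by (cases x) (auto simp: ennreal_powr_ennreal ennreal_mult[symmetric] powr_add)

lemma ennreal_powr_inverse_le_iff:
  assumes "0 < r" shows "ennreal_powr x (1 / r) \<le> y \<longleftrightarrow> x \<le> ennreal_powr y r"
proof
  assume "ennreal_powr x (1 / r) \<le> y"
  then have "ennreal_powr (ennreal_powr x (1 / r)) r \<le> ennreal_powr y r"
    using assms by (intro ennreal_powr_mono) auto
  then show "x \<le> ennreal_powr y r" using assms by (simp add: ennreal_powr_powr)
next
  assume "x \<le> ennreal_powr y r"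
  then have "ennreal_powr x (1 / r) \<le> ennreal_powr (ennreal_powr y r) (1 / r)"
    using assms by (intro ennreal_powr_mono) auto
  then show "ennreal_powr x (1 / r) \<le> y" using assms by (simp add: ennreal_powr_powr)
qed

lemma borel_measurable_ennreal_powr [measurable]:
  assumes [measurable]: "f \<in> borel_measurable M"
  shows "(\<lambda>x. ennreal_powr (f x) r) \<in> borel_measurable M"
  unfolding ennreal_powr_def by measurable

lemma conj_exp_props:
  assumes "1 < p"
  shows "1 < conj_exp p" "1 / p + 1 / conj_exp p = 1" "(conj_exp p - 1) * p = conj_exp p"
  using assms by (auto simp: conj_exp_def field_simps)

text \<open>Young's inequality for the two functions divided by their norms.\<close>

lemma nn_integral_Hoelder:
  fixes f g :: "'a \<Rightarrow> real"
  assumes p: "1 < p"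
    and [measurable]: "f \<in> borel_measurable M" "g \<in> borel_measurable M"
    and nonneg: "\<And>x. 0 \<le> f x" "\<And>x. 0 \<le> g x"
  shows "(\<integral>\<^sup>+x. ennreal (f x * g x) \<partial>M)
    \<le> ennreal_powr (\<integral>\<^sup>+x. ennreal (f x powr conj_exp p) \<partial>M) (1 / conj_exp p)
      * ennreal_powr (\<integral>\<^sup>+x. ennreal (g x powr p) \<partial>M) (1 / p)"
proof -
  define p' where "p' = conj_exp p"
  note cp = conj_exp_props[OF p, folded p'_def]
  define A where "A = (\<integral>\<^sup>+x. ennreal (f x powr p') \<partial>M)"
  define B where "B = (\<integral>\<^sup>+x. ennreal (g x powr p) \<partial>M)"
  have trivial: "(\<integral>\<^sup>+x. ennreal (f x * g x) \<partial>M) = 0" if "A = 0 \<or> B = 0"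
  proof -
    have "AE x in M. f x = 0 \<or> g x = 0"
    proof (cases "A = 0")
      case True
      then have "AE x in M. ennreal (f x powr p') = 0"
        unfolding A_def by (subst (asm) nn_integral_0_iff_AE) auto
      then show ?thesis by eventually_elim simp
    next
      case False
      with that have "B = 0" by simp
      then have "AE x in M. ennreal (g x powr p) = 0"
        unfolding B_def by (subst (asm) nn_integral_0_iff_AE) auto
      then show ?thesis by eventually_elim simp
    qed
    then have "AE x in M. ennreal (f x * g x) = 0" by eventually_elim auto
    then show ?thesis by (subst nn_integral_0_iff_AE) auto
  qed
  consider "A = 0 \<or> B = 0" | "A \<noteq> 0" "B \<noteq> 0" "A = top \<or> B = top"
    | a b where "A = ennreal a" "B = ennreal b" "0 < a" "0 < b"
    by (cases A; cases B) (auto simp: less_le)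
  then have "(\<integral>\<^sup>+x. ennreal (f x * g x) \<partial>M) \<le> ennreal_powr A (1 / p') * ennreal_powr B (1 / p)"
  proof cases
    case 1
    then show ?thesis using trivial by simp
  next
    case 2
    then show ?thesis by (auto simp: ennreal_mult_top ennreal_top_mult)
  next
    case (3 a b)
    define s where "s = a powr (1 / p')"
    define t where "t = b powr (1 / p)"
    have st: "0 < s" "0 < t" "s powr p' = a" "t powr p = b"
      using 3 cp p by (auto simp: s_def t_def powr_powr)
    have "f x * g x \<le> s * t * (f x powr p' / (a * p') + g x powr p / (b * p))" for x
    proof -
      have "(f x / s) * (g x / t) \<le> (f x / s) powr p' / p' + (g x / t) powr p / p"
        using cp p nonneg st by (intro Youngs_inequality) auto
      also have "\<dots> = f x powr p' / (a * p') + g x powr p / (b * p)"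
        using st nonneg by (simp add: powr_divide mult.commute)
      finally show ?thesis using st by (simp add: field_simps)
    qed
    then have "(\<integral>\<^sup>+x. ennreal (f x * g x) \<partial>M)
        \<le> (\<integral>\<^sup>+x. ennreal (s * t / (a * p')) * ennreal (f x powr p')
              + ennreal (s * t / (b * p)) * ennreal (g x powr p) \<partial>M)"
      using st cp p 3
      by (intro nn_integral_mono)
         (auto simp: ennreal_mult[symmetric] ennreal_plus[symmetric] algebra_simps simp del: ennreal_plus intro!: ennreal_leI)
    also have "\<dots> = ennreal (s * t / (a * p')) * A + ennreal (s * t / (b * p)) * B"
      by (simp add: nn_integral_add nn_integral_cmult A_def B_def)
    also have "\<dots> = ennreal (s * t / (a * p') * a + s * t / (b * p) * b)"
      using 3 st cp p by (simp add: ennreal_mult[symmetric] ennreal_plus[symmetric] del: ennreal_plus)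
    also have "s * t / (a * p') * a + s * t / (b * p) * b = s * t * (1 / p + 1 / p')"
      using 3 by (simp add: algebra_simps)
    also have "\<dots> = s * t" using cp by simp
    also have "ennreal (s * t) = ennreal_powr A (1 / p') * ennreal_powr B (1 / p)"
      using 3 by (simp add: ennreal_powr_ennreal s_def t_def ennreal_mult)
    finally show ?thesis .
  qed
  then show ?thesis by (simp add: A_def B_def p'_def)
qed

text \<open>Each summand is at most the largest one, whose power is one of the terms on the right.\<close>

lemma sum_powr_le:
  fixes a :: "'i \<Rightarrow> real"
  assumes I: "finite I" and a: "\<And>i. i \<in> I \<Longrightarrow> 0 \<le> a i" and s: "0 \<le> s"
  shows "(\<Sum>i\<in>I. a i) powr s \<le> real (card I) powr s * (\<Sum>i\<in>I. a i powr s)"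
proof (cases "I = {}")
  case False
  obtain k where k: "k \<in> I" "a k = Max (a ` I)"
    using Max_in[of "a ` I"] False I by fastforce
  have le: "a i \<le> a k" if "i \<in> I" for i
    unfolding k(2) using I that by (intro Max_ge) auto
  have "(\<Sum>i\<in>I. a i) \<le> real (card I) * a k"
    using sum_bounded_above[of I a "a k"] le by simp
  then have "(\<Sum>i\<in>I. a i) powr s \<le> (real (card I) * a k) powr s"
    using a s by (intro powr_mono2 sum_nonneg) auto
  also have "\<dots> = real (card I) powr s * a k powr s"
    using a k by (simp add: powr_mult)
  also have "a k powr s \<le> (\<Sum>i\<in>I. a i powr s)"
    using k I by (intro member_le_sum) auto
  finally show ?thesis by (simp add: mult_left_mono)
qed simp

text \<open>With \<open>T\<close> the sum of the \<open>a n\<close>, each term is \<open>a n * a n powr (s - 1) \<le> a n * T powr (s -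
  1)\<close>.\<close>

lemma suminf_ennreal_powr_le:
  fixes a :: "nat \<Rightarrow> ennreal"
  assumes s: "1 \<le> s"
  shows "(\<Sum>n. ennreal_powr (a n) s) \<le> ennreal_powr (\<Sum>n. a n) s"
proof (cases "s = 1")
  case False
  define T where "T = (\<Sum>n. a n)"
  have le: "a n \<le> T" for n
    unfolding T_def using sum_le_suminf[of a "{n}"] by (simp add: summableI)
  have "(\<Sum>n. ennreal_powr (a n) s) \<le> (\<Sum>n. a n * ennreal_powr T (s - 1))"
  proof (intro suminf_le summableI)
    fix n
    have "ennreal_powr (a n) s = a n * ennreal_powr (a n) (s - 1)"
      using ennreal_powr_add[of "a n" 1 "s - 1"] by simp
    also have "\<dots> \<le> a n * ennreal_powr T (s - 1)"
      using s le by (intro mult_left_mono ennreal_powr_mono) auto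
    finally show "ennreal_powr (a n) s \<le> a n * ennreal_powr T (s - 1)" .
  qed
  also have "\<dots> = T * ennreal_powr T (s - 1)"
    by (simp add: T_def)
  also have "\<dots> = ennreal_powr T s"
    using ennreal_powr_add[of T 1 "s - 1"] by simp
  finally show ?thesis by (simp add: T_def)
qed simp

section \<open>Measurability of matrix functions\<close>

lemma continuous_on_matrix_mult:
  fixes f :: "'a::topological_space \<Rightarrow> complex^'n^'n" and g :: "'a \<Rightarrow> complex^'n^'n"
  assumes "continuous_on S f" "continuous_on S g"
  shows "continuous_on S (\<lambda>x. f x ** g x)"
  unfolding matrix_matrix_mult_def
  by (intro continuous_on_vec_lambda continuous_on_sum continuous_on_mult continuous_on_component assms)

lemma continuous_on_adjoint_mat:
  fixes f :: "'a::topological_space \<Rightarrow> complex^'n^'n"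
  assumes "continuous_on S f"
  shows "continuous_on S (\<lambda>x. adjoint_mat (f x))"
  unfolding adjoint_mat_def
  by (intro continuous_on_vec_lambda continuous_on_cnj continuous_on_component assms)

lemma borel_measurable_matrix_mult [measurable]:
  fixes f g :: "'a \<Rightarrow> complex^'n^'n"
  assumes "f \<in> borel_measurable M" "g \<in> borel_measurable M"
  shows "(\<lambda>x. f x ** g x) \<in> borel_measurable M"
  by (rule borel_measurable_continuous_Pair[OF assms])
     (intro continuous_on_matrix_mult continuous_intros)

lemma borel_measurable_matrix_vector [measurable]:
  fixes f :: "'a \<Rightarrow> complex^'n^'n" and g :: "'a \<Rightarrow> complex^'n"
  assumes "f \<in> borel_measurable M" "g \<in> borel_measurable M"
  shows "(\<lambda>x. f x *v g x) \<in> borel_measurable M"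
  by (rule borel_measurable_continuous_Pair[OF assms])
     (unfold matrix_vector_mult_def, intro continuous_on_vec_lambda continuous_on_sum continuous_on_mult continuous_on_component continuous_intros)

lemma borel_measurable_op_norm [measurable]:
  fixes f :: "'a \<Rightarrow> complex^'n^'n"
  assumes "f \<in> borel_measurable M" shows "(\<lambda>x. op_norm (f x)) \<in> borel_measurable M"
  by (rule borel_measurable_continuous_on[OF continuous_on_op_norm assms])

text \<open>The rows of a unitary matrix are unit vectors, so its entries have modulus at most one.\<close>

lemma compact_unitary_mat: "compact {P :: complex^'n^'n. unitary_mat P}"
proof -
  have "closed {P :: complex^'n^'n. unitary_mat P}"
    unfolding unitary_mat_def
    by (intro closed_Collect_conj closed_Collect_eq continuous_on_matrix_mult continuous_on_adjoint_mat
        continuous_intros)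
  moreover have "norm P \<le> real (CARD('n)) * real (CARD('n))" if "unitary_mat P" for P :: "complex^'n^'n"
  proof -
    have "norm (P $ i $ j) \<le> 1" for i j
    proof -
      have "(P ** adjoint_mat P) $ i $ i = 1" using that by (simp add: unitary_mat_def mat_def)
      then have "(\<Sum>k\<in>UNIV. P $ i $ k * cnj (P $ i $ k)) = 1"
        by (simp add: matrix_matrix_mult_def adjoint_mat_def)
      then have "complex_of_real (\<Sum>k\<in>UNIV. (norm (P $ i $ k))\<^sup>2) = 1"
        unfolding of_real_sum complex_norm_square .
      then have "(\<Sum>k\<in>UNIV. (norm (P $ i $ k))\<^sup>2) = 1"
        by (simp only: of_real_eq_1_iff)
      moreover have "(norm (P $ i $ j))\<^sup>2 \<le> (\<Sum>k\<in>UNIV. (norm (P $ i $ k))\<^sup>2)"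
        by (intro member_le_sum) auto
      ultimately show ?thesis by (simp add: power_le_one_iff abs_square_le_1)
    qed
    then have row: "norm (P $ i) \<le> real (CARD('n))" for i
      using sum_bounded_above[of UNIV "\<lambda>j. norm (P $ i $ j)" 1]
      unfolding norm_vec_def[of "P $ i"]
      by (intro order_trans[OF L2_set_le_sum]) auto
    have "norm P \<le> (\<Sum>i\<in>UNIV. norm (P $ i))"
      unfolding norm_vec_def[of P] by (rule L2_set_le_sum) auto
    also have "\<dots> \<le> real (CARD('n)) * real (CARD('n))"
      using sum_bounded_above[of UNIV "\<lambda>i. norm (P $ i)" "real (CARD('n))"] row by simp
    finally show ?thesis .
  qed
  then have "bounded {P :: complex^'n^'n. unitary_mat P}"
    by (auto simp: bounded_iff)
  ultimately show ?thesis by (simp add: compact_eq_bounded_closed)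
qed

text \<open>A diagonalization cannot be chosen continuously, but all diagonalizations with given
  spectral bounds form a compact set, and the power is a continuous function of the
  diagonalization. So the matrices whose power lies in a closed set are the continuous image of a
  compact set.\<close>

lemma compact_mat_powr_preimage:
  fixes C :: "(complex^'n^'n) set"
  assumes C: "closed C" and ab: "0 < a"
  shows "compact ((\<lambda>(P, l). P ** real_diag_mat l ** adjoint_mat P) `
    {(P :: complex^'n^'n, l). unitary_mat P \<and> (\<forall>i. a \<le> l $ i \<and> l $ i \<le> b) \<and>
        P ** real_diag_mat (\<chi> i. l $ i powr r) ** adjoint_mat P \<in> C})" (is "compact (?\<Phi> ` ?K)")
proof (rule compact_continuous_image)
  have diag: "continuous_on S (\<lambda>x. real_diag_mat (f x))"
    if "\<And>i. continuous_on S (\<lambda>x. f x $ i)" for S and f :: "(complex^'n^'n) \<times> (real^'n) \<Rightarrow> real^'n"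
  proof -
    have *: "continuous_on S (\<lambda>x. if i = j then complex_of_real (f x $ i) else 0)" for i j
      using that[of i] by (cases "i = j") (auto intro: continuous_intros)
    show ?thesis unfolding real_diag_mat_def by (intro continuous_on_vec_lambda *)
  qed
  show "continuous_on ?K ?\<Phi>"
    unfolding case_prod_beta
    by (intro continuous_on_matrix_mult continuous_on_adjoint_mat diag continuous_on_component continuous_intros)
  define L :: "((complex^'n^'n) \<times> (real^'n)) set"
    where "L = {P. unitary_mat P} \<times> cbox (\<chi> i. a) (\<chi> i. b)"
  define h :: "(complex^'n^'n) \<times> (real^'n) \<Rightarrow> complex^'n^'n"
    where "h x = fst x ** real_diag_mat (\<chi> i. snd x $ i powr r) ** adjoint_mat (fst x)" for x
  have L: "compact L" unfolding L_def by (intro compact_Times compact_unitary_mat compact_cbox)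
  have "continuous_on L h"
    unfolding h_def
  proof (intro continuous_on_matrix_mult continuous_on_adjoint_mat diag continuous_on_fst continuous_on_id)
    fix i
    have "continuous_on L (\<lambda>x. snd x $ i powr r)"
    proof (intro continuous_on_powr continuous_on_component continuous_intros ballI)
      fix x assume "x \<in> L"
      then have "a \<le> snd x $ i" by (auto simp: L_def mem_box_cart)
      then show "snd x $ i \<noteq> 0" using ab by simp
    qed
    then show "continuous_on L (\<lambda>x. (\<chi> i. snd x $ i powr r) $ i)" by simp
  qed
  then have "closed (h -` C \<inter> L)"
    using L C by (simp add: continuous_on_closed_vimage compact_imp_closed)
  moreover have eq: "?K = L \<inter> (h -` C \<inter> L)"
    by (auto simp: L_def h_def mem_box_cart)
  ultimately show "compact ?K"
    unfolding eq using L by (intro compact_Int_closed)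
qed

text \<open>The positive definite matrices are exhausted by countably many of the preceding sets, with
  spectral bounds \<open>1/m\<close> and \<open>m\<close>. The values at the points where the matrix is not positive
  definite are uncontrolled; completeness of the measure absorbs them.\<close>

lemma borel_measurable_mat_powr:
  fixes U :: "'a \<Rightarrow> complex^'n^'n"
  assumes [measurable]: "U \<in> borel_measurable (completion M)"
    and pd: "AE x in completion M. pos_def_mat (U x)"
  shows "(\<lambda>x. mat_powr (U x) r) \<in> borel_measurable (completion M)"
  unfolding borel_eq_closed
proof (rule measurable_measure_of)
  fix C :: "(complex^'n^'n) set" assume "C \<in> Collect closed"
  then have C: "closed C" by simp
  define R where "R m = (\<lambda>(P, l). P ** real_diag_mat l ** adjoint_mat P) `
    {(P :: complex^'n^'n, l). unitary_mat P \<and> (\<forall>i. 1 / real (Suc m) \<le> l $ i \<and> l $ i \<le> real (Suc m)) \<and>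
        P ** real_diag_mat (\<chi> i. l $ i powr r) ** adjoint_mat P \<in> C}" for m
  have R: "R m \<in> sets borel" for m
    unfolding R_def by (intro borel_compact compact_mat_powr_preimage C) simp
  have R_in: "mat_powr A r \<in> C" if "A \<in> R m" for A m
    using that unfolding R_def by (auto simp: mat_powr_eqI[OF _ refl])
  have in_R: "\<exists>m. A \<in> R m" if A: "pos_def_mat A" and AC: "mat_powr A r \<in> C" for A
  proof -
    obtain P l where U: "unitary_mat P" and eq: "A = P ** real_diag_mat l ** adjoint_mat P"
      and l: "\<And>i. 0 < l $ i"
      using pos_def_diagonalization[OF A] by metis
    obtain m where m: "(\<Sum>i\<in>UNIV. l $ i + 1 / l $ i) \<le> real m"
      using real_arch_simple by blast
    have "l $ i + 1 / l $ i \<le> real m" for i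
    proof -
      have "l $ i + 1 / l $ i \<le> (\<Sum>i\<in>UNIV. l $ i + 1 / l $ i)"
        using l by (intro member_le_sum[of i UNIV "\<lambda>i. l $ i + 1 / l $ i"]) (auto intro!: add_nonneg_nonneg simp: less_imp_le)
      then show ?thesis using m by simp
    qed
    then have bd: "l $ i \<le> real (Suc m) \<and> 1 / l $ i \<le> real (Suc m)" for i
      using l[of i] by (smt (verit) divide_pos_pos of_nat_Suc)
    have "1 / real (Suc m) \<le> l $ i \<and> l $ i \<le> real (Suc m)" for i
      using l[of i] bd[of i] by (auto simp: field_simps)
    then have "A \<in> R m"
      unfolding R_def using U eq AC mat_powr_eqI[OF U eq, of r]
      by (intro image_eqI[of _ _ "(P, l)"]) auto
    then show ?thesis ..
  qed
  define X where "X = (\<lambda>x. mat_powr (U x) r) -` C \<inter> space (completion M)"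
  define Y where "Y = U -` (\<Union>m. R m) \<inter> space (completion M)"
  have Y: "Y \<in> sets (completion M)"
    unfolding Y_def using R by (intro measurable_sets[OF assms(1)]) auto
  have "Y \<subseteq> X" using R_in by (auto simp: X_def Y_def)
  obtain N where N: "N \<in> null_sets (completion M)" "{x \<in> space (completion M). \<not> pos_def_mat (U x)} \<subseteq> N"
    using AE_E[OF pd] by (metis null_setsI)
  have "X - Y \<subseteq> N" using in_R N(2) by (fastforce simp: X_def Y_def)
  then have "X - Y \<in> sets (completion M)" using N(1) by (rule completion.complete)
  moreover have "X = Y \<union> (X - Y)" using \<open>Y \<subseteq> X\<close> by blast
  ultimately have "X \<in> sets (completion M)" using Y by (metis sets.Un)
  then show "(\<lambda>x. mat_powr (U x) r) -` C \<inter> space (completion M) \<in> sets (completion M)"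
    by (simp add: X_def)
qed auto

section \<open>Almost extremal bases\<close>

text \<open>The columns of a matrix whose determinant is more than half of the supremum form the basis.
  By Cramer's rule a coordinate of \<open>z\<close> is a quotient of two such determinants, the numerator
  having \<open>z\<close> as one of its columns, and so has modulus at most two. The factor two is the price
  for working with a supremum that need not be attained.\<close>

lemma almost_extremal_basis:
  fixes E :: "(complex^'n) set"
  assumes E: "bounded E" and A0: "\<And>j. column j A0 \<in> E" "det A0 \<noteq> 0"
  shows "\<exists>A :: complex^'n^'n. (\<forall>j. column j A \<in> E) \<and>
    (\<forall>z\<in>E. \<exists>c. z = A *v c \<and> (\<forall>j. norm (c $ j) \<le> 2))"
proof -
  obtain B where B: "\<And>z. z \<in> E \<Longrightarrow> norm z \<le> B" using E by (auto simp: bounded_iff)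
  define S where "S = {norm (det A) | A :: complex^'n^'n. \<forall>j. column j A \<in> E}"
  have det_le: "norm (det A) \<le> (\<Sum>\<pi>\<in>{\<pi>. \<pi> permutes (UNIV :: 'n set)}. B ^ CARD('n))"
    if A: "\<forall>j. column j A \<in> E" for A :: "complex^'n^'n"
  proof -
    have ent: "norm (A $ i $ j) \<le> B" for i j
    proof -
      have "norm (A $ i $ j) = norm (column j A $ i)" by (simp add: column_def)
      also have "\<dots> \<le> norm (column j A)" by (rule Finite_Cartesian_Product.norm_nth_le)
      also have "\<dots> \<le> B" using A B by auto
      finally show ?thesis .
    qed
    have "norm (det A) \<le> (\<Sum>\<pi>\<in>{\<pi>. \<pi> permutes (UNIV :: 'n set)}.
        norm (of_int (sign \<pi>) * (\<Prod>i\<in>UNIV. A $ i $ \<pi> i)))"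
      unfolding det_def by (rule norm_sum)
    also have "\<dots> \<le> (\<Sum>\<pi>\<in>{\<pi>. \<pi> permutes (UNIV :: 'n set)}. B ^ CARD('n))"
    proof (rule sum_mono)
      fix \<pi> :: "'n \<Rightarrow> 'n"
      have "norm (of_int (sign \<pi>) * (\<Prod>i\<in>UNIV. A $ i $ \<pi> i)) = (\<Prod>i\<in>UNIV. norm (A $ i $ \<pi> i))"
        by (simp add: norm_mult prod_norm sign_def)
      also have "\<dots> \<le> (\<Prod>i\<in>(UNIV :: 'n set). B)"
        by (intro prod_mono) (auto simp: ent)
      finally show "norm (of_int (sign \<pi>) * (\<Prod>i\<in>UNIV. A $ i $ \<pi> i)) \<le> B ^ CARD('n)" by simp
    qed
    finally show ?thesis .
  qed
  have bdd: "bdd_above S" by (rule bdd_aboveI) (use det_le in \<open>auto simp: S_def\<close>)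
  have "norm (det A0) \<in> S" using A0 by (auto simp: S_def)
  then have "norm (det A0) \<le> Sup S" using bdd by (rule cSup_upper)
  then have pos: "0 < Sup S" using A0(2) by (smt (verit) zero_less_norm_iff)
  then have "\<exists>s\<in>S. Sup S / 2 < s"
    using \<open>norm (det A0) \<in> S\<close> bdd by (subst less_cSup_iff[symmetric]) auto
  then obtain A where A: "\<And>j. column j A \<in> E" and big: "Sup S / 2 < norm (det A)"
    by (auto simp: S_def)
  have nz: "det A \<noteq> 0" using pos big by auto
  show ?thesis
  proof (intro exI[of _ A] conjI allI ballI)
    show "column j A \<in> E" for j by (rule A)
    fix z assume z: "z \<in> E"
    obtain A' where inv: "A ** A' = mat 1"
      using nz by (auto simp: invertible_det_nz[symmetric] invertible_def)
    define c where "c = A' *v z"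
    have Ac: "A *v c = z" by (simp add: c_def matrix_vector_mul_assoc inv)
    have "norm (c $ k) \<le> 2" for k
    proof -
      let ?R = "(\<chi> i j. if j = k then (A *v c) $ i else A $ i $ j) :: complex^'n^'n"
      have "column j ?R = (if j = k then z else column j A)" for j
        by (simp add: column_def Ac vec_eq_iff)
      then have "norm (det ?R) \<in> S" using A z unfolding S_def by (intro CollectI exI[of _ ?R]) auto
      then have "norm (det ?R) \<le> Sup S" using bdd by (rule cSup_upper)
      then have "norm (c $ k) * norm (det A) \<le> Sup S" by (simp add: cramer_lemma norm_mult)
      also have "\<dots> \<le> 2 * norm (det A)" using big by simp
      finally show ?thesis using nz by simp
    qed
    then show "\<exists>c. z = A *v c \<and> (\<forall>j. norm (c $ j) \<le> 2)" using Ac by metis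
  qed
qed

section \<open>Averages against a pair of matrix weights on a finite measure space\<close>

text \<open>In the application the measure is Lebesgue measure on a cube, \<open>W\<close> is \<open>U\<^bsup>1/q\<^esup>\<close> with inverse
  \<open>Wi\<close>, and \<open>D\<close> and \<open>T\<close> are \<open>V\<^bsup>1/p\<^esup>\<close> and \<open>V\<^bsup>-1/p\<^esup>\<close>.\<close>

locale matrix_weight_pair = finite_measure M for M :: "'a measure" +
  fixes W Wi D T :: "'a \<Rightarrow> complex^'n^'n"
  assumes meas [measurable]: "W \<in> borel_measurable M" "Wi \<in> borel_measurable M"
      "D \<in> borel_measurable M" "T \<in> borel_measurable M"
    and inv_W: "AE x in M. Wi x ** W x = mat 1"
    and inv_D: "AE y in M. T y ** D y = mat 1"
    and sa_W: "AE x in M. self_adjoint_mat (W x)"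
    and sa_T: "AE y in M. self_adjoint_mat (T y)"
    and nontrivial: "emeasure M (space M) \<noteq> 0"
begin

definition energy :: "real \<Rightarrow> ('a \<Rightarrow> complex^'n) \<Rightarrow> ennreal" where
  "energy p f = (\<integral>\<^sup>+y. ennreal (norm (D y *v f y) powr p) \<partial>M)"

text \<open>The result of estimating \<open>|W(x) f(y)|\<close> by \<open>|W(x) T(y)| |D(y) f(y)|\<close> in the \<open>q\<close>-th power of
  the weighted norm of the integral of \<open>f\<close>.\<close>

definition kernel_integral :: "real \<Rightarrow> ('a \<Rightarrow> complex^'n) \<Rightarrow> ennreal" where
  "kernel_integral q f = (\<integral>\<^sup>+x. ennreal_powr
     (\<integral>\<^sup>+y. ennreal (op_norm (W x ** T y) * norm (D y *v f y)) \<partial>M) q \<partial>M)"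

lemma AE_witness: assumes "AE x in M. P x" shows "\<exists>x. P x"
  using assms nontrivial eventually_happens'[of "ae_filter M" P] by (auto simp: ae_filter_eq_bot_iff)

lemma norm_W_f_le: "AE y in M. norm (W x *v f y) \<le> op_norm (W x ** T y) * norm (D y *v f y)"
  using inv_D
proof eventually_elim
  case (elim y)
  have "W x *v f y = (W x ** T y) *v (D y *v f y)"
    by (simp add: matrix_vector_mul_assoc elim flip: matrix_mul_assoc)
  then show ?case using norm_matrix_vector_le by metis
qed

text \<open>The inner integral is finite for almost every \<open>x\<close>, hence for some \<open>x\<close> at which \<open>W\<close> is
  invertible, and there it bounds a multiple of the integral of \<open>|f|\<close>.\<close>

lemma integrable_of_kernel_integral:
  assumes [measurable]: "f \<in> borel_measurable M" and fin: "kernel_integral q f < top"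
  shows "integrable M f"
proof (rule integrableI_bounded)
  have "AE x in M. ennreal_powr
     (\<integral>\<^sup>+y. ennreal (op_norm (W x ** T y) * norm (D y *v f y)) \<partial>M) q \<noteq> \<infinity>"
    using fin unfolding kernel_integral_def by (intro nn_integral_PInf_AE) auto
  from AE_witness[OF AE_conjI[OF inv_W this]] obtain x where inv: "Wi x ** W x = mat 1"
    and fx: "(\<integral>\<^sup>+y. ennreal (op_norm (W x ** T y) * norm (D y *v f y)) \<partial>M) < top"
    by (auto simp: less_top[symmetric])
  have "(\<integral>\<^sup>+y. ennreal (norm (f y)) \<partial>M)
      \<le> (\<integral>\<^sup>+y. ennreal (op_norm (Wi x)) * ennreal (op_norm (W x ** T y) * norm (D y *v f y)) \<partial>M)"
  proof (rule nn_integral_mono_AE)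
    show "AE y in M. ennreal (norm (f y))
        \<le> ennreal (op_norm (Wi x)) * ennreal (op_norm (W x ** T y) * norm (D y *v f y))"
      using norm_W_f_le[of x f]
    proof eventually_elim
      case (elim y)
      have "f y = Wi x *v (W x *v f y)" by (simp add: matrix_vector_mul_assoc inv)
      then have "norm (f y) \<le> op_norm (Wi x) * norm (W x *v f y)"
        using norm_matrix_vector_le by metis
      also have "\<dots> \<le> op_norm (Wi x) * (op_norm (W x ** T y) * norm (D y *v f y))"
        using elim by (intro mult_left_mono) auto
      finally show ?case by (simp add: ennreal_mult[symmetric])
    qed
  qed
  also have "\<dots> = ennreal (op_norm (Wi x)) * (\<integral>\<^sup>+y. ennreal (op_norm (W x ** T y) * norm (D y *v f y)) \<partial>M)"
    by (rule nn_integral_cmult) measurable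
  also have "\<dots> < \<infinity>" using fx by (simp add: ennreal_mult_less_top)
  finally show "(\<integral>\<^sup>+y. ennreal (norm (f y)) \<partial>M) < \<infinity>" .
qed fact

lemma norm_average_le_kernel_integral:
  assumes q: "0 < q" and int: "integrable M f"
  shows "(\<integral>\<^sup>+x. ennreal (norm (W x *v integral\<^sup>L M f) powr q) \<partial>M) \<le> kernel_integral q f"
  unfolding kernel_integral_def
proof (rule nn_integral_mono)
  fix x
  have intW: "integrable M (\<lambda>y. W x *v f y)"
    by (rule integrable_bounded_linear[OF bounded_linear_matrix_vector int])
  have "ennreal (norm (W x *v integral\<^sup>L M f)) = ennreal (norm (\<integral>y. W x *v f y \<partial>M))"
    by (simp add: integral_bounded_linear[OF bounded_linear_matrix_vector int])
  also have "\<dots> \<le> (\<integral>\<^sup>+y. ennreal (norm (W x *v f y)) \<partial>M)"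
    using intW by (rule integral_norm_bound_ennreal)
  also have "\<dots> \<le> (\<integral>\<^sup>+y. ennreal (op_norm (W x ** T y) * norm (D y *v f y)) \<partial>M)"
    by (rule nn_integral_mono_AE) (use norm_W_f_le[of x f] in \<open>eventually_elim, simp add: ennreal_leI\<close>)
  finally have "ennreal_powr (ennreal (norm (W x *v integral\<^sup>L M f))) q
      \<le> ennreal_powr (\<integral>\<^sup>+y. ennreal (op_norm (W x ** T y) * norm (D y *v f y)) \<partial>M) q"
    using q by (intro ennreal_powr_mono) auto
  then show "ennreal (norm (W x *v integral\<^sup>L M f) powr q)
      \<le> ennreal_powr (\<integral>\<^sup>+y. ennreal (op_norm (W x ** T y) * norm (D y *v f y)) \<partial>M) q"
    by (simp add: ennreal_powr_ennreal)
qed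

lemma kernel_integral_le:
  assumes [measurable]: "f \<in> borel_measurable M" and p: "1 < p" and q: "0 < q"
  shows "kernel_integral q f
    \<le> (\<integral>\<^sup>+x. ennreal_powr (\<integral>\<^sup>+y. ennreal (op_norm (W x ** T y) powr conj_exp p) \<partial>M) (q / conj_exp p) \<partial>M)
      * ennreal_powr (energy p f) (q / p)"
proof -
  have "kernel_integral q f \<le> (\<integral>\<^sup>+x. ennreal_powr
      (\<integral>\<^sup>+y. ennreal (op_norm (W x ** T y) powr conj_exp p) \<partial>M) (q / conj_exp p)
      * ennreal_powr (energy p f) (q / p) \<partial>M)"
    unfolding kernel_integral_def
  proof (rule nn_integral_mono)
    fix x assume "x \<in> space M"
    have "(\<integral>\<^sup>+y. ennreal (op_norm (W x ** T y) * norm (D y *v f y)) \<partial>M)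
       \<le> ennreal_powr (\<integral>\<^sup>+y. ennreal (op_norm (W x ** T y) powr conj_exp p) \<partial>M) (1 / conj_exp p)
         * ennreal_powr (energy p f) (1 / p)"
      unfolding energy_def using p by (intro nn_integral_Hoelder) auto
    then show "ennreal_powr (\<integral>\<^sup>+y. ennreal (op_norm (W x ** T y) * norm (D y *v f y)) \<partial>M) q
       \<le> ennreal_powr (\<integral>\<^sup>+y. ennreal (op_norm (W x ** T y) powr conj_exp p) \<partial>M) (q / conj_exp p)
         * ennreal_powr (energy p f) (q / p)"
      using ennreal_powr_mono[OF less_imp_le[OF q]]
      by (fastforce simp: ennreal_powr_mult ennreal_powr_powr)
  qed
  also have "\<dots> = (\<integral>\<^sup>+x. ennreal_powr (\<integral>\<^sup>+y. ennreal (op_norm (W x ** T y) powr conj_exp p) \<partial>M) (q / conj_exp p) \<partial>M)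
      * ennreal_powr (energy p f) (q / p)"
    by (rule nn_integral_multc) measurable
  finally show ?thesis .
qed

text \<open>Jensen's inequality for the measure with density \<open>|D f|\<close> brings the power \<open>q\<close> inside, and
  Tonelli's theorem lets the bound on the \<open>x\<close>-integral of the kernel act for each \<open>y\<close>.\<close>

lemma kernel_integral_le_1:
  assumes [measurable]: "f \<in> borel_measurable M" and q: "1 \<le> q"
    and Y: "AE y in M. (\<integral>\<^sup>+x. ennreal (op_norm (W x ** T y) powr q) \<partial>M) \<le> Y"
  shows "kernel_integral q f \<le> Y * ennreal_powr (energy 1 f) q"
proof -
  interpret pair_sigma_finite M M ..
  define h where "h y = norm (D y *v f y)" for y
  have [measurable]: "h \<in> borel_measurable M" unfolding h_def by measurable
  have h0: "0 \<le> h y" for y by (simp add: h_def)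
  define N where "N = (\<integral>\<^sup>+y. ennreal (h y) \<partial>M)"
  have N: "energy 1 f = N" by (simp add: energy_def N_def h_def)
  \<comment> \<open>The case distinction is forced by \<open>ennreal_powr 0 0 = 0\<close>.\<close>
  define c where "c = (if q = 1 then 1 else ennreal_powr N (q - 1))"
  have cN: "c * N = ennreal_powr N q"
    using ennreal_powr_add[of N "q - 1" 1] by (auto simp: c_def)
  have jensen: "ennreal_powr (\<integral>\<^sup>+y. ennreal (op_norm (W x ** T y) * h y) \<partial>M) q
      \<le> c * (\<integral>\<^sup>+y. ennreal (op_norm (W x ** T y) powr q * h y) \<partial>M)" for x
  proof (cases "q = 1")
    case False
    then have q1: "1 < q" using q by simp
    define q' where "q' = conj_exp q"
    note cq = conj_exp_props[OF q1, folded q'_def]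
    have split: "op_norm (W x ** T y) * h y = h y powr (1 / q') * (op_norm (W x ** T y) * h y powr (1 / q))" for y
    proof -
      have "h y = h y powr (1 / q') * h y powr (1 / q)"
        using cq h0[of y] by (simp add: powr_add[symmetric] add.commute)
      then show ?thesis by (simp add: mult_ac)
    qed
    have "(\<integral>\<^sup>+y. ennreal (op_norm (W x ** T y) * h y) \<partial>M)
        \<le> ennreal_powr (\<integral>\<^sup>+y. ennreal ((h y powr (1 / q')) powr q') \<partial>M) (1 / q')
          * ennreal_powr (\<integral>\<^sup>+y. ennreal ((op_norm (W x ** T y) * h y powr (1 / q)) powr q) \<partial>M) (1 / q)"
      unfolding split q'_def using q1 by (intro nn_integral_Hoelder) auto
    also have "\<dots> = ennreal_powr N (1 / q') * ennreal_powr (\<integral>\<^sup>+y. ennreal (op_norm (W x ** T y) powr q * h y) \<partial>M) (1 / q)"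
      using q1 cq h0 by (simp add: powr_powr powr_mult N_def)
    finally have "ennreal_powr (\<integral>\<^sup>+y. ennreal (op_norm (W x ** T y) * h y) \<partial>M) q
       \<le> ennreal_powr (ennreal_powr N (1 / q') * ennreal_powr (\<integral>\<^sup>+y. ennreal (op_norm (W x ** T y) powr q * h y) \<partial>M) (1 / q)) q"
      using q by (intro ennreal_powr_mono) auto
    also have "\<dots> = ennreal_powr N (q / q') * (\<integral>\<^sup>+y. ennreal (op_norm (W x ** T y) powr q * h y) \<partial>M)"
      using q by (simp add: ennreal_powr_mult ennreal_powr_powr)
    also have "q / q' = q - 1" using q1 by (simp add: q'_def conj_exp_def)
    finally show ?thesis using False by (simp add: c_def)
  qed (simp add: c_def)
  have "kernel_integral q f \<le> (\<integral>\<^sup>+x. c * (\<integral>\<^sup>+y. ennreal (op_norm (W x ** T y) powr q * h y) \<partial>M) \<partial>M)"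
    unfolding kernel_integral_def h_def[symmetric] by (intro nn_integral_mono jensen)
  also have "\<dots> = c * (\<integral>\<^sup>+x. \<integral>\<^sup>+y. ennreal (op_norm (W x ** T y) powr q * h y) \<partial>M \<partial>M)"
    by (rule nn_integral_cmult) measurable
  also have "(\<integral>\<^sup>+x. \<integral>\<^sup>+y. ennreal (op_norm (W x ** T y) powr q * h y) \<partial>M \<partial>M)
      = (\<integral>\<^sup>+y. \<integral>\<^sup>+x. ennreal (op_norm (W x ** T y) powr q * h y) \<partial>M \<partial>M)"
    by (rule Fubini'[symmetric]) measurable
  also have "\<dots> = (\<integral>\<^sup>+y. (\<integral>\<^sup>+x. ennreal (op_norm (W x ** T y) powr q) \<partial>M) * ennreal (h y) \<partial>M)"
    by (intro nn_integral_cong) (simp add: ennreal_mult h0 nn_integral_multc)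
  also have "\<dots> \<le> (\<integral>\<^sup>+y. Y * ennreal (h y) \<partial>M)"
    by (rule nn_integral_mono_AE) (use Y in \<open>eventually_elim, auto intro: mult_right_mono\<close>)
  also have "\<dots> = Y * N" unfolding N_def by (rule nn_integral_cmult) measurable
  finally have "kernel_integral q f \<le> c * (Y * N)" by (simp add: mult_left_mono)
  then show ?thesis by (simp add: N cN[symmetric] mult_ac)
qed


text \<open>For \<open>f = k T (T z)\<close> one has \<open>D f = k T z\<close>, while the pairing of \<open>f\<close> with \<open>z\<close> is \<open>k |T
  z|\<^sup>2\<close>.\<close>

lemma dual_test:
  assumes [measurable]: "k \<in> borel_measurable M" and k: "\<And>y. 0 \<le> k y"
    and test: "\<And>f. f \<in> borel_measurable M \<Longrightarrow> energy p f \<le> 1 \<Longrightarrow> integrable M f \<and> integral\<^sup>L M f \<bullet> z \<le> g"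
    and le1: "(\<integral>\<^sup>+y. ennreal ((k y * norm (T y *v z)) powr p) \<partial>M) \<le> 1"
  shows "(\<integral>\<^sup>+y. ennreal (k y * (norm (T y *v z))\<^sup>2) \<partial>M) \<le> ennreal g"
proof -
  define f where "f y = k y *\<^sub>R (T y *v (T y *v z))" for y
  have f[measurable]: "f \<in> borel_measurable M" unfolding f_def by measurable
  have "energy p f = (\<integral>\<^sup>+y. ennreal ((k y * norm (T y *v z)) powr p) \<partial>M)"
    unfolding energy_def
  proof (rule nn_integral_cong_AE)
    show "AE y in M. ennreal (norm (D y *v f y) powr p) = ennreal ((k y * norm (T y *v z)) powr p)"
      using inv_D
    proof eventually_elim
      case (elim y)
      then have DT: "D y ** T y = mat 1" using matrix_left_right_inverse by metis
      have "D y *v (T y *v w) = w" for w by (simp add: matrix_vector_mul_assoc DT)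
      then have "D y *v f y = k y *\<^sub>R (T y *v z)"
        unfolding f_def by (simp add: linear_scale[OF matrix_vector_mul_linear])
      then show ?case using k[of y] by simp
    qed
  qed
  with le1 have int: "integrable M f" and le: "integral\<^sup>L M f \<bullet> z \<le> g"
    using test[OF f] by auto
  have eq: "AE y in M. f y \<bullet> z = k y * (norm (T y *v z))\<^sup>2"
    using sa_T by eventually_elim (simp add: f_def inner_self_adjoint power2_norm_eq_inner)
  have "(\<integral>\<^sup>+y. ennreal (k y * (norm (T y *v z))\<^sup>2) \<partial>M) = (\<integral>\<^sup>+y. ennreal (f y \<bullet> z) \<partial>M)"
    by (rule nn_integral_cong_AE) (use eq in \<open>eventually_elim, simp\<close>)
  also have "\<dots> = ennreal (\<integral>y. f y \<bullet> z \<partial>M)"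
  proof (rule nn_integral_eq_integral)
    show "AE y in M. 0 \<le> f y \<bullet> z" using eq by eventually_elim (simp add: k)
  qed (use int in simp)
  also have "(\<integral>y. f y \<bullet> z \<partial>M) = integral\<^sup>L M f \<bullet> z"
    using int by (intro integral_inner_left) auto
  finally show ?thesis using le by (simp add: ennreal_leI)
qed

text \<open>The test function is the extremal one in the Hoelder inequality, \<open>k = |T z| powr (p' - 2)\<close>
  up to normalisation. It is cut off to the sets where \<open>|T z|\<close> is bounded, since only there is the
  integral known in advance to be finite.\<close>

lemma dual_norm_le:
  assumes p: "1 < p" and g: "0 \<le> g"
    and test: "\<And>f. f \<in> borel_measurable M \<Longrightarrow> energy p f \<le> 1 \<Longrightarrow> integrable M f \<and> integral\<^sup>L M f \<bullet> z \<le> g"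
  shows "(\<integral>\<^sup>+y. ennreal (norm (T y *v z) powr conj_exp p) \<partial>M) \<le> ennreal (g powr conj_exp p)"
proof -
  define p' where "p' = conj_exp p"
  note cp = conj_exp_props[OF p, folded p'_def]
  define h where "h y = norm (T y *v z)" for y
  have [measurable]: "h \<in> borel_measurable M" unfolding h_def by measurable
  have h0: "0 \<le> h y" for y by (simp add: h_def)
  define S where "S m = {y \<in> space M. h y \<le> real m}" for m :: nat
  have [measurable]: "S m \<in> sets M" for m unfolding S_def by measurable
  have bound: "(\<integral>\<^sup>+y. ennreal (h y powr p') * indicator (S m) y \<partial>M) \<le> ennreal (g powr p')" (is "?I \<le> _") for m
  proof -
    have "?I \<le> (\<integral>\<^sup>+y. ennreal (real m powr p') \<partial>M)"
      using cp by (intro nn_integral_mono) (auto simp: S_def h0 intro!: ennreal_leI powr_mono2 split: split_indicator)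
    also have "\<dots> < top" by (simp add: emeasure_eq_measure ennreal_mult[symmetric])
    finally obtain I where I: "?I = ennreal I" "0 \<le> I" by (cases ?I) auto
    show ?thesis
    proof (cases "I = 0")
      case False
      then have I0: "0 < I" using I by simp
      define k where "k y = I powr (- 1 / p) * (indicator (S m) y * h y powr (p' - 2))" for y
      have [measurable]: "k \<in> borel_measurable M" unfolding k_def by measurable
      have kp: "(k y * h y) powr p = (1 / I) * (h y powr p' * indicator (S m) y)" for y
      proof (cases "h y = 0 \<or> y \<notin> S m")
        case False
        then have "0 < h y" using h0[of y] by auto
        then have "(k y * h y) = I powr (- 1 / p) * h y powr (p' - 1)"
          using False powr_add[of "h y" "p' - 2" 1] by (simp add: k_def mult_ac)
        then have "(k y * h y) powr p = I powr (- 1) * h y powr ((p' - 1) * p)"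
          using p by (simp add: powr_mult powr_powr)
        then show ?thesis using False I0 by (simp add: cp powr_minus_divide)
      qed (use p cp in \<open>auto simp: k_def\<close>)
      have kh: "k y * (h y)\<^sup>2 = I powr (- 1 / p) * (h y powr p' * indicator (S m) y)" for y
      proof (cases "h y = 0 \<or> y \<notin> S m")
        case False
        then have "0 < h y" using h0[of y] by auto
        then show ?thesis
          using False powr_add[of "h y" "p' - 2" 2] by (simp add: k_def mult_ac)
      qed (use p cp in \<open>auto simp: k_def\<close>)
      have int: "(\<integral>\<^sup>+y. ennreal (c * (h y powr p' * indicator (S m) y)) \<partial>M) = ennreal (c * I)"
        if "0 \<le> c" for c
      proof -
        have "(\<integral>\<^sup>+y. ennreal (c * (h y powr p' * indicator (S m) y)) \<partial>M)
            = (\<integral>\<^sup>+y. ennreal c * (ennreal (h y powr p') * indicator (S m) y) \<partial>M)"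
          using that by (intro nn_integral_cong) (auto simp: ennreal_mult split: split_indicator)
        also have "\<dots> = ennreal c * ?I" by (rule nn_integral_cmult) measurable
        finally show ?thesis using I that by (simp add: ennreal_mult)
      qed
      have "(\<integral>\<^sup>+y. ennreal (k y * (h y)\<^sup>2) \<partial>M) \<le> ennreal g"
        unfolding h_def
      proof (rule dual_test[OF _ _ test])
        show "(\<integral>\<^sup>+y. ennreal ((k y * norm (T y *v z)) powr p) \<partial>M) \<le> 1"
          unfolding h_def[symmetric] kp using I0 by (subst int) auto
      qed (auto simp: k_def)
      then have "ennreal (I powr (- 1 / p) * I) \<le> ennreal g"
        unfolding kh by (subst (asm) int) auto
      also have "I powr (- 1 / p) * I = I powr (1 / p')"
      proof -
        have "1 / p' = - 1 / p + 1" using cp by (simp add: field_simps)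
        then show ?thesis using I0 by (simp only: powr_add powr_one)
      qed
      finally have "I powr (1 / p') \<le> g" using g by simp
      then have "(I powr (1 / p')) powr p' \<le> g powr p'" using cp by (intro powr_mono2) auto
      then show ?thesis using I0 cp I by (simp add: powr_powr ennreal_leI)
    qed (use I in simp)
  qed
  have "incseq S" by (auto simp: incseq_def S_def)
  moreover have "(\<Union>m. S m) = space M" by (auto simp: S_def intro: real_arch_simple)
  ultimately have "(SUP m. emeasure (density M (\<lambda>y. ennreal (h y powr p'))) (S m))
      = emeasure (density M (\<lambda>y. ennreal (h y powr p'))) (space M)"
    by (subst SUP_emeasure_incseq) auto
  moreover have "emeasure (density M (\<lambda>y. ennreal (h y powr p'))) (S m) \<le> ennreal (g powr p')" for m
    using bound[of m] by (simp add: emeasure_density)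
  ultimately have "emeasure (density M (\<lambda>y. ennreal (h y powr p'))) (space M) \<le> ennreal (g powr p')"
    by (metis SUP_least)
  then show ?thesis
    by (simp add: emeasure_density h_def p'_def cong: nn_integral_cong)
qed

text \<open>If \<open>|T z|\<close> exceeded \<open>g\<close> by a fixed amount on a set of positive measure, the normalised
  indicator of that set, divided by \<open>|T z|\<close>, would be a test function violating the hypothesis.\<close>

lemma dual_esssup_le:
  assumes g: "0 \<le> g"
    and test: "\<And>f. f \<in> borel_measurable M \<Longrightarrow> energy 1 f \<le> 1 \<Longrightarrow> integrable M f \<and> integral\<^sup>L M f \<bullet> z \<le> g"
  shows "AE y in M. norm (T y *v z) \<le> g"
proof -
  define h where "h y = norm (T y *v z)" for y
  have [measurable]: "h \<in> borel_measurable M" unfolding h_def by measurable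
  define S where "S m = {y \<in> space M. g + 1 / real (Suc m) \<le> h y}" for m :: nat
  have [measurable]: "S m \<in> sets M" for m unfolding S_def by measurable
  have null: "S m \<in> null_sets M" for m
  proof (rule ccontr)
    define \<delta> where "\<delta> = measure M (S m)"
    assume "S m \<notin> null_sets M"
    then have d: "0 < \<delta>" by (simp add: \<delta>_def null_sets_def emeasure_eq_measure zero_less_measure_iff)
    have em: "emeasure M (S m) = ennreal \<delta>" by (simp add: \<delta>_def emeasure_eq_measure)
    define c where "c = g + 1 / real (Suc m)"
    have c: "0 < c" "g < c" using g by (simp_all add: c_def add_nonneg_pos)
    define k where "k y = indicator (S m) y / (\<delta> * h y)" for y
    have [measurable]: "k \<in> borel_measurable M" unfolding k_def by measurable
    have hS: "c \<le> h y" if "y \<in> S m" for y using that by (simp add: S_def c_def)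
    have "(\<integral>\<^sup>+y. ennreal (k y * (h y)\<^sup>2) \<partial>M) \<le> ennreal g"
      unfolding h_def
    proof (rule dual_test[OF _ _ test])
      have "(\<integral>\<^sup>+y. ennreal ((k y * h y) powr 1) \<partial>M) \<le> (\<integral>\<^sup>+y. ennreal (1 / \<delta>) * indicator (S m) y \<partial>M)"
        using d hS c by (intro nn_integral_mono) (force simp: k_def split: split_indicator)
      also have "\<dots> = 1" using d by (simp add: nn_integral_cmult em ennreal_mult[symmetric])
      finally show "(\<integral>\<^sup>+y. ennreal ((k y * norm (T y *v z)) powr 1) \<partial>M) \<le> 1"
        by (simp add: h_def)
    qed (use d in \<open>auto simp: k_def h_def\<close>)
    moreover have "ennreal c \<le> (\<integral>\<^sup>+y. ennreal (k y * (h y)\<^sup>2) \<partial>M)"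
    proof -
      have "ennreal c = (\<integral>\<^sup>+y. ennreal (c / \<delta>) * indicator (S m) y \<partial>M)"
        using d c by (simp add: nn_integral_cmult em ennreal_mult[symmetric])
      also have "\<dots> \<le> (\<integral>\<^sup>+y. ennreal (k y * (h y)\<^sup>2) \<partial>M)"
      proof (rule nn_integral_mono)
        fix y
        show "ennreal (c / \<delta>) * indicator (S m) y \<le> ennreal (k y * (h y)\<^sup>2)"
        proof (cases "y \<in> S m")
          case True
          then have "c \<le> h y" by (rule hS)
          then have "k y * (h y)\<^sup>2 = h y / \<delta>" using True d c by (simp add: k_def power2_eq_square)
          then show ?thesis using True \<open>c \<le> h y\<close> d by (simp add: divide_right_mono ennreal_leI)
        qed simp
      qed
      finally show ?thesis .
    qed
    ultimately have "ennreal c \<le> ennreal g" by (rule order_trans[rotated])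
    then show False using c g by simp
  qed
  then have "AE y in M. \<forall>m. y \<notin> S m" by (auto simp: AE_all_countable intro: AE_not_in)
  then show ?thesis
    using AE_space
  proof eventually_elim
    case (elim y)
    have "norm (T y *v z) \<le> g + e" if e: "0 < e" for e
    proof -
      obtain m where "1 / real (Suc m) < e" using nat_approx_posE[OF e] .
      moreover have "h y < g + 1 / real (Suc m)" using elim by (auto simp: S_def not_le)
      ultimately show ?thesis by (simp add: h_def)
    qed
    then show ?case by (rule field_le_epsilon)
  qed
qed

lemma positive_measure_sublevel:
  assumes [measurable]: "H \<in> borel_measurable M"
  obtains m :: nat where "0 < measure M {x \<in> space M. H x \<le> real m}"
proof -
  have "\<exists>m::nat. {x \<in> space M. H x \<le> real m} \<notin> null_sets M"
  proof (rule ccontr)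
    assume "\<not> ?thesis"
    then have "(\<Union>m::nat. {x \<in> space M. H x \<le> real m}) \<in> null_sets M"
      by (intro null_sets_UN) auto
    moreover have "(\<Union>m::nat. {x \<in> space M. H x \<le> real m}) = space M"
      by (auto intro: real_arch_simple)
    ultimately show False using nontrivial by auto
  qed
  then obtain m :: nat where "{x \<in> space M. H x \<le> real m} \<notin> null_sets M" by blast
  moreover have "{x \<in> space M. H x \<le> real m} \<in> sets M" by measurable
  ultimately show ?thesis
    by (intro that[of m]) (auto simp: null_sets_def emeasure_eq_measure zero_less_measure_iff)
qed

text \<open>On a set of positive measure the inverse of \<open>W\<close> is bounded, so there \<open>|W z|\<close> is at least a
  fixed multiple of \<open>|z|\<close>.\<close>

lemma bounded_of_weighted_bound:
  assumes q: "0 < q" and K: "0 \<le> K"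
    and bound: "\<And>z. z \<in> E \<Longrightarrow> (\<integral>\<^sup>+x. ennreal (norm (W x *v z) powr q) \<partial>M) \<le> ennreal (K powr q)"
  shows "bounded E"
proof -
  obtain m :: nat where m: "0 < measure M {x \<in> space M. op_norm (Wi x) \<le> real m}"
    using positive_measure_sublevel[of "\<lambda>x. op_norm (Wi x)"] by auto
  define S where "S = {x \<in> space M. op_norm (Wi x) \<le> real m}"
  define \<delta> where "\<delta> = measure M S"
  have d: "0 < \<delta>" using m by (simp add: \<delta>_def S_def)
  have [measurable]: "S \<in> sets M" unfolding S_def by measurable
  have "norm z \<le> (real m powr q * K powr q / \<delta>) powr (1 / q)" if z: "z \<in> E" for z
  proof -
    have "ennreal (norm z powr q * \<delta>) = (\<integral>\<^sup>+x. ennreal (norm z powr q) * indicator S x \<partial>M)"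
      using d by (simp add: nn_integral_cmult emeasure_eq_measure \<delta>_def ennreal_mult)
    also have "\<dots> \<le> (\<integral>\<^sup>+x. ennreal (real m powr q) * ennreal (norm (W x *v z) powr q) \<partial>M)"
    proof (rule nn_integral_mono_AE)
      show "AE x in M. ennreal (norm z powr q) * indicator S x
          \<le> ennreal (real m powr q) * ennreal (norm (W x *v z) powr q)"
        using inv_W
      proof eventually_elim
        case (elim x)
        show ?case
        proof (cases "x \<in> S")
          case True
          have "z = Wi x *v (W x *v z)" by (simp add: matrix_vector_mul_assoc elim)
          then have "norm z \<le> op_norm (Wi x) * norm (W x *v z)"
            using norm_matrix_vector_le by metis
          also have "\<dots> \<le> real m * norm (W x *v z)"
            using True by (intro mult_right_mono) (auto simp: S_def)
          finally have "norm z powr q \<le> (real m * norm (W x *v z)) powr q"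
            using q by (intro powr_mono2) auto
          then show ?thesis using True by (simp add: powr_mult ennreal_mult[symmetric] ennreal_leI)
        qed simp
      qed
    qed
    also have "\<dots> = ennreal (real m powr q) * (\<integral>\<^sup>+x. ennreal (norm (W x *v z) powr q) \<partial>M)"
      by (rule nn_integral_cmult) measurable
    also have "\<dots> \<le> ennreal (real m powr q) * ennreal (K powr q)"
      using bound[OF z] by (rule mult_left_mono) simp
    finally have "norm z powr q * \<delta> \<le> real m powr q * K powr q"
      by (simp add: ennreal_mult[symmetric])
    then have "norm z powr q \<le> real m powr q * K powr q / \<delta>"
      using d by (simp add: field_simps)
    then have "(norm z powr q) powr (1 / q) \<le> (real m powr q * K powr q / \<delta>) powr (1 / q)"
      using q by (intro powr_mono2) auto
    then show ?thesis using q by (simp add: powr_powr)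
  qed
  then show ?thesis by (auto simp: bounded_iff)
qed

text \<open>A small multiple of the indicator of a set on which \<open>D\<close> is bounded, times a coordinate
  vector, is an admissible test function. This makes the set of integrals of test functions
  spanning.\<close>

lemma test_integral_axis:
  assumes p: "1 \<le> p"
  obtains c :: real where "0 < c"
    "\<And>j. \<exists>f. f \<in> borel_measurable M \<and> energy p f \<le> 1 \<and> integral\<^sup>L M f = c *\<^sub>R axis j 1"
proof -
  obtain m :: nat where m: "0 < measure M {x \<in> space M. op_norm (D x) \<le> real m}"
    using positive_measure_sublevel[of "\<lambda>x. op_norm (D x)"] by auto
  define S where "S = {x \<in> space M. op_norm (D x) \<le> real m}"
  define V where "V = measure M (space M)"
  have [measurable]: "S \<in> sets M" unfolding S_def by measurable
  have V: "0 \<le> V" by (simp add: V_def)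
  \<comment> \<open>Chosen so that \<open>(t m) powr p * V \<le> t m V \<le> 1\<close>, the first step because \<open>t m \<le> 1\<close>.\<close>
  define t where "t = 1 / ((real m + 1) * (V + 1))"
  have t: "0 < t" using V by (simp add: t_def add_nonneg_pos)
  have "real m / (real m + 1) * (1 / (V + 1)) \<le> 1 * (1 / (V + 1))"
    using V by (intro mult_right_mono) auto
  then have tm: "t * real m \<le> 1 / (V + 1)" by (simp add: t_def)
  have tm1: "t * real m \<le> 1" using V by (intro order_trans[OF tm]) simp
  have tmV: "(t * real m) powr p * V \<le> 1"
  proof -
    have "(t * real m) powr p \<le> t * real m"
    proof (cases "m = 0")
      case False
      then show ?thesis using powr_mono'[of 1 p "t * real m"] p t tm1 by simp
    qed (use t in simp)
    then have "(t * real m) powr p * V \<le> (1 / (V + 1)) * V"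
      using V tm by (intro mult_right_mono) auto
    also have "\<dots> \<le> 1" using V by simp
    finally show ?thesis .
  qed
  have norm_axis: "norm (axis j 1 :: complex^'n) = 1" for j
    by (rule norm_Basis) (simp add: axis_in_Basis_iff Basis_complex_def)
  have "\<exists>f. f \<in> borel_measurable M \<and> energy p f \<le> 1 \<and> integral\<^sup>L M f = (t * measure M S) *\<^sub>R axis j 1" for j
  proof -
    define f where "f y = (t * indicator S y) *\<^sub>R (axis j 1 :: complex^'n)" for y
    have "f \<in> borel_measurable M" unfolding f_def by measurable
    moreover have "energy p f \<le> 1"
    proof -
      have "energy p f \<le> (\<integral>\<^sup>+y. ennreal ((t * real m) powr p) \<partial>M)"
        unfolding energy_def
      proof (intro nn_integral_mono ennreal_leI powr_mono2)
        fix y assume "y \<in> space M"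
        show "norm (D y *v f y) \<le> t * real m"
        proof (cases "y \<in> S")
          case True
          have "norm (D y *v f y) \<le> op_norm (D y) * norm (f y)" by (rule norm_matrix_vector_le)
          also have "\<dots> \<le> real m * t"
            using True t by (intro mult_mono) (auto simp: S_def f_def norm_axis)
          finally show ?thesis by (simp add: mult.commute)
        qed (use t in \<open>simp add: f_def\<close>)
      qed (use p in auto)
      also have "\<dots> = ennreal ((t * real m) powr p * V)"
        by (simp add: emeasure_eq_measure V_def ennreal_mult)
      also have "\<dots> \<le> 1" using tmV by simp
      finally show ?thesis .
    qed
    moreover have "integral\<^sup>L M f = (t * measure M S) *\<^sub>R axis j 1"
      unfolding f_def by (subst integral_scaleR_left) (auto simp: emeasure_eq_measure less_top[symmetric])
    ultimately show ?thesis by blast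
  qed
  moreover have "0 < t * measure M S" using t m by (simp add: S_def)
  ultimately show ?thesis using that by blast
qed

text \<open>The hypothesis bounds one test function at a time; the conclusion provides one function of
  \<open>x\<close> for all of them. Every integral of a test function has bounded coordinates in an almost
  extremal basis consisting of such integrals, so it is enough to add up the contributions of the
  basis.\<close>

lemma test_average_envelope:
  assumes p: "1 \<le> p" and q: "1 \<le> q" and K: "0 \<le> K"
    and bound: "\<And>f. f \<in> borel_measurable M \<Longrightarrow> energy p f \<le> 1 \<Longrightarrow>
      (\<integral>\<^sup>+x. ennreal (norm (W x *v integral\<^sup>L M f) powr q) \<partial>M) \<le> ennreal (K powr q)"
  obtains G where "G \<in> borel_measurable M" "\<And>x. 0 \<le> G x"
    "\<And>f x. f \<in> borel_measurable M \<Longrightarrow> energy p f \<le> 1 \<Longrightarrow> norm (W x *v integral\<^sup>L M f) \<le> G x"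
    "(\<integral>\<^sup>+x. ennreal (G x powr q) \<partial>M)
      \<le> ennreal ((2 * real CARD('n)) powr q * real CARD('n) * K powr q)"
proof -
  define E where "E = {integral\<^sup>L M f | f. f \<in> borel_measurable M \<and> energy p f \<le> 1}"
  have bd: "(\<integral>\<^sup>+x. ennreal (norm (W x *v z) powr q) \<partial>M) \<le> ennreal (K powr q)" if "z \<in> E" for z
    using that bound by (auto simp: E_def)
  have "bounded E" using q K bd by (intro bounded_of_weighted_bound[of q K]) auto
  obtain c :: real where c: "0 < c" and "\<And>j. \<exists>f. f \<in> borel_measurable M \<and> energy p f \<le> 1 \<and>
      integral\<^sup>L M f = c *\<^sub>R (axis j 1 :: complex^'n)"
    using test_integral_axis[OF p] by blast
  then have ax: "c *\<^sub>R (axis j 1 :: complex^'n) \<in> E" for j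
    unfolding E_def by (smt (verit) mem_Collect_eq)
  define A0 :: "complex^'n^'n" where "A0 = mat (complex_of_real c)"
  have "column j A0 = c *\<^sub>R axis j 1" for j
    by (simp add: A0_def column_def mat_def axis_def vec_eq_iff complex_eq_iff)
  then have "column j A0 \<in> E" for j using ax by simp
  moreover have "det A0 \<noteq> 0"
    using c by (subst det_diagonal) (auto simp: A0_def mat_def)
  ultimately have "\<exists>A :: complex^'n^'n. (\<forall>j. column j A \<in> E) \<and>
      (\<forall>z\<in>E. \<exists>c. z = A *v c \<and> (\<forall>j. norm (c $ j) \<le> 2))"
    using almost_extremal_basis[OF \<open>bounded E\<close>] by blast
  then obtain A :: "complex^'n^'n" where col: "\<forall>j. column j A \<in> E"
    and coord: "\<forall>z\<in>E. \<exists>c. z = A *v c \<and> (\<forall>j. norm (c $ j) \<le> 2)"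
    by blast
  have A: "column j A \<in> E" for j using col by blast
  define G where "G x = 2 * (\<Sum>j\<in>UNIV. norm (W x *v column j A))" for x
  show ?thesis
  proof (rule that[of G])
    show "G \<in> borel_measurable M" unfolding G_def by measurable
    show "0 \<le> G x" for x unfolding G_def by (intro mult_nonneg_nonneg sum_nonneg) auto
    show "norm (W x *v integral\<^sup>L M f) \<le> G x" if "f \<in> borel_measurable M" "energy p f \<le> 1" for f x
    proof -
      have "integral\<^sup>L M f \<in> E" using that by (auto simp: E_def)
      then obtain c where z: "integral\<^sup>L M f = A *v c" and c: "\<And>j. norm (c $ j) \<le> 2"
        using coord by blast
      have "W x *v integral\<^sup>L M f = (\<Sum>j\<in>UNIV. c $ j *s (W x *v column j A))"
        unfolding z matrix_mult_sum[of A]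
        by (simp add: linear_sum[OF matrix_vector_mul_linear] vector_scalar_commute)
      then have "norm (W x *v integral\<^sup>L M f) \<le> (\<Sum>j\<in>UNIV. norm (c $ j *s (W x *v column j A)))"
        by (simp add: norm_sum)
      also have "\<dots> \<le> (\<Sum>j\<in>UNIV. 2 * norm (W x *v column j A))"
        using c by (intro sum_mono) (simp add: norm_vector_scale mult_right_mono)
      also have "\<dots> = G x" by (simp add: G_def sum_distrib_left)
      finally show ?thesis .
    qed
    have "(\<integral>\<^sup>+x. ennreal (G x powr q) \<partial>M)
        \<le> (\<integral>\<^sup>+x. ennreal ((2 * real CARD('n)) powr q) * (\<Sum>j\<in>UNIV. ennreal (norm (W x *v column j A) powr q)) \<partial>M)"
    proof (rule nn_integral_mono)
      fix x
      have "G x powr q = 2 powr q * (\<Sum>j\<in>UNIV. norm (W x *v column j A)) powr q"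
        unfolding G_def by (rule powr_mult)
      also have "\<dots> \<le> 2 powr q * (real CARD('n) powr q * (\<Sum>j\<in>UNIV. norm (W x *v column j A) powr q))"
        using q by (intro mult_left_mono sum_powr_le) auto
      finally show "ennreal (G x powr q)
          \<le> ennreal ((2 * real CARD('n)) powr q) * (\<Sum>j\<in>UNIV. ennreal (norm (W x *v column j A) powr q))"
        by (simp add: powr_mult ennreal_mult[symmetric] sum_nonneg mult_ac ennreal_leI)
    qed
    also have "\<dots> = ennreal ((2 * real CARD('n)) powr q) *
        (\<Sum>j\<in>UNIV. \<integral>\<^sup>+x. ennreal (norm (W x *v column j A) powr q) \<partial>M)"
      by (simp add: nn_integral_cmult nn_integral_sum del: sum_ennreal)
    also have "\<dots> \<le> ennreal ((2 * real CARD('n)) powr q) * (\<Sum>j\<in>(UNIV :: 'n set). ennreal (K powr q))"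
      by (intro mult_left_mono sum_mono bd A) simp
    also have "\<dots> = ennreal ((2 * real CARD('n)) powr q * real CARD('n) * K powr q)"
      by (simp add: ennreal_mult mult_ac ennreal_of_nat_eq_real_of_nat)
    finally show "(\<integral>\<^sup>+x. ennreal (G x powr q) \<partial>M)
        \<le> ennreal ((2 * real CARD('n)) powr q * real CARD('n) * K powr q)" .
  qed
qed

text \<open>At fixed \<open>x\<close> the envelope \<open>G(x)\<close> bounds the pairing of every integral of a test function
  with \<open>W(x) e\<close>, for \<open>e\<close> in the standard basis of \<open>\<complex>\<^sup>n\<close> as a real vector space; by duality it
  bounds the \<open>L\<^sup>p\<^sup>'\<close> norm of \<open>y \<mapsto> T(y) W(x) e\<close>. Since \<open>W(x)\<close> and \<open>T(y)\<close> are Hermitian, these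
  vectors control \<open>|W(x) T(y)|\<close>.\<close>

lemma kernel_le_of_averages_bounded:
  assumes p: "1 < p" and q: "1 \<le> q" and K: "0 \<le> K"
    and int: "\<And>f. f \<in> borel_measurable M \<Longrightarrow> energy p f \<le> 1 \<Longrightarrow> integrable M f"
    and bound: "\<And>f. f \<in> borel_measurable M \<Longrightarrow> energy p f \<le> 1 \<Longrightarrow>
      (\<integral>\<^sup>+x. ennreal (norm (W x *v integral\<^sup>L M f) powr q) \<partial>M) \<le> ennreal (K powr q)"
  shows "(\<integral>\<^sup>+x. ennreal_powr (\<integral>\<^sup>+y. ennreal (op_norm (W x ** T y) powr conj_exp p) \<partial>M) (q / conj_exp p) \<partial>M)
    \<le> ennreal ((real DIM(complex^'n) powr conj_exp p * real DIM(complex^'n)) powr (q / conj_exp p)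
          * ((2 * real CARD('n)) powr q * real CARD('n)) * K powr q)"
proof -
  define p' where "p' = conj_exp p"
  note cp = conj_exp_props[OF p, folded p'_def]
  define b where "b = real DIM(complex^'n)"
  have b: "0 \<le> b" by (simp add: b_def)
  obtain G where [measurable]: "G \<in> borel_measurable M" and G0: "\<And>x. 0 \<le> G x"
    and G: "\<And>f x. f \<in> borel_measurable M \<Longrightarrow> energy p f \<le> 1 \<Longrightarrow> norm (W x *v integral\<^sup>L M f) \<le> G x"
    and GK: "(\<integral>\<^sup>+x. ennreal (G x powr q) \<partial>M)
      \<le> ennreal ((2 * real CARD('n)) powr q * real CARD('n) * K powr q)"
    using test_average_envelope[OF _ q K bound] p by (metis less_imp_le)
  have "(\<integral>\<^sup>+x. ennreal_powr (\<integral>\<^sup>+y. ennreal (op_norm (W x ** T y) powr p') \<partial>M) (q / p') \<partial>M)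
      \<le> (\<integral>\<^sup>+x. ennreal ((b powr p' * b) powr (q / p')) * ennreal (G x powr q) \<partial>M)"
  proof (rule nn_integral_mono_AE)
    show "AE x in M. ennreal_powr (\<integral>\<^sup>+y. ennreal (op_norm (W x ** T y) powr p') \<partial>M) (q / p')
        \<le> ennreal ((b powr p' * b) powr (q / p')) * ennreal (G x powr q)"
      using sa_W
    proof eventually_elim
      case (elim x)
      have dual: "(\<integral>\<^sup>+y. ennreal (norm (T y *v (W x *v e)) powr p') \<partial>M) \<le> ennreal (G x powr p')"
        if e: "e \<in> Basis" for e
        unfolding p'_def
      proof (rule dual_norm_le[OF p G0])
        fix f :: "'a \<Rightarrow> complex^'n" assume f: "f \<in> borel_measurable M" "energy p f \<le> 1"
        have "integral\<^sup>L M f \<bullet> (W x *v e) = (W x *v integral\<^sup>L M f) \<bullet> e"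
          by (simp add: inner_self_adjoint elim)
        also have "\<dots> \<le> norm (W x *v integral\<^sup>L M f) * norm e" by (rule norm_cauchy_schwarz)
        also have "\<dots> \<le> G x" using e G[OF f] by simp
        finally show "integrable M f \<and> integral\<^sup>L M f \<bullet> (W x *v e) \<le> G x" using int[OF f] by blast
      qed
      have "(\<integral>\<^sup>+y. ennreal (op_norm (W x ** T y) powr p') \<partial>M)
          \<le> (\<integral>\<^sup>+y. ennreal (b powr p') * (\<Sum>e\<in>Basis. ennreal (norm (T y *v (W x *v e)) powr p')) \<partial>M)"
      proof (rule nn_integral_mono_AE)
        show "AE y in M. ennreal (op_norm (W x ** T y) powr p')
            \<le> ennreal (b powr p') * (\<Sum>e\<in>Basis. ennreal (norm (T y *v (W x *v e)) powr p'))"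
          using sa_T
        proof eventually_elim
          case (elim y)
          have "op_norm (W x ** T y) powr p' \<le> (\<Sum>e\<in>Basis. norm (T y *v (W x *v e))) powr p'"
            using cp by (intro powr_mono2 op_norm_le_sum_Basis elim \<open>self_adjoint_mat (W x)\<close>) auto
          also have "\<dots> \<le> b powr p' * (\<Sum>e\<in>Basis. norm (T y *v (W x *v e)) powr p')"
            unfolding b_def using cp by (intro sum_powr_le) auto
          finally show ?case by (simp add: ennreal_mult[symmetric] sum_nonneg ennreal_leI)
        qed
      qed
      also have "\<dots> = ennreal (b powr p') * (\<Sum>e\<in>Basis. \<integral>\<^sup>+y. ennreal (norm (T y *v (W x *v e)) powr p') \<partial>M)"
        by (simp add: nn_integral_cmult nn_integral_sum del: sum_ennreal)
      also have "\<dots> \<le> ennreal (b powr p') * (\<Sum>e\<in>(Basis :: (complex^'n) set). ennreal (G x powr p'))"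
        by (intro mult_left_mono sum_mono dual) auto
      also have "\<dots> = ennreal ((b powr p' * b) * G x powr p')"
        using b by (simp add: ennreal_mult mult_ac ennreal_of_nat_eq_real_of_nat b_def)
      finally have "ennreal_powr (\<integral>\<^sup>+y. ennreal (op_norm (W x ** T y) powr p') \<partial>M) (q / p')
          \<le> ennreal_powr (ennreal ((b powr p' * b) * G x powr p')) (q / p')"
        using q cp by (intro ennreal_powr_mono) auto
      also have "\<dots> = ennreal ((b powr p' * b) powr (q / p')) * ennreal (G x powr q)"
        using b cp by (subst ennreal_powr_ennreal) (auto simp: powr_mult powr_powr ennreal_mult)
      finally show ?case .
    qed
  qed
  also have "\<dots> = ennreal ((b powr p' * b) powr (q / p')) * (\<integral>\<^sup>+x. ennreal (G x powr q) \<partial>M)"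
    by (rule nn_integral_cmult) measurable
  also have "\<dots> \<le> ennreal ((b powr p' * b) powr (q / p')) *
      ennreal ((2 * real CARD('n)) powr q * real CARD('n) * K powr q)"
    using GK by (rule mult_left_mono) simp
  finally show ?thesis by (simp add: ennreal_mult b_def p'_def mult_ac)
qed

text \<open>Duality gives \<open>|W(x) T(y)| \<le> b G(x)\<close> for almost every \<open>y\<close> with an exceptional set depending
  on \<open>x\<close>; by Fubini's theorem the quantifiers can be exchanged before integrating over \<open>x\<close>.\<close>

lemma kernel_le_of_averages_bounded_1:
  assumes q: "1 \<le> q" and K: "0 \<le> K"
    and int: "\<And>f. f \<in> borel_measurable M \<Longrightarrow> energy 1 f \<le> 1 \<Longrightarrow> integrable M f"
    and bound: "\<And>f. f \<in> borel_measurable M \<Longrightarrow> energy 1 f \<le> 1 \<Longrightarrow>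
      (\<integral>\<^sup>+x. ennreal (norm (W x *v integral\<^sup>L M f) powr q) \<partial>M) \<le> ennreal (K powr q)"
  shows "AE y in M. (\<integral>\<^sup>+x. ennreal (op_norm (W x ** T y) powr q) \<partial>M)
    \<le> ennreal (real DIM(complex^'n) powr q * ((2 * real CARD('n)) powr q * real CARD('n)) * K powr q)"
proof -
  interpret pair_sigma_finite M M ..
  define b where "b = real DIM(complex^'n)"
  have b: "0 \<le> b" by (simp add: b_def)
  obtain G where [measurable]: "G \<in> borel_measurable M" and G0: "\<And>x. 0 \<le> G x"
    and G: "\<And>f x. f \<in> borel_measurable M \<Longrightarrow> energy 1 f \<le> 1 \<Longrightarrow> norm (W x *v integral\<^sup>L M f) \<le> G x"
    and GK: "(\<integral>\<^sup>+x. ennreal (G x powr q) \<partial>M)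
      \<le> ennreal ((2 * real CARD('n)) powr q * real CARD('n) * K powr q)"
    using test_average_envelope[OF _ q K bound] by (metis order_refl)
  have "AE x in M. AE y in M. op_norm (W x ** T y) \<le> b * G x"
    using sa_W
  proof eventually_elim
    case (elim x)
    have dual: "AE y in M. norm (T y *v (W x *v e)) \<le> G x" if e: "e \<in> Basis" for e
    proof (rule dual_esssup_le[OF G0])
      fix f :: "'a \<Rightarrow> complex^'n" assume f: "f \<in> borel_measurable M" "energy 1 f \<le> 1"
      have "integral\<^sup>L M f \<bullet> (W x *v e) = (W x *v integral\<^sup>L M f) \<bullet> e"
        by (simp add: inner_self_adjoint elim)
      also have "\<dots> \<le> norm (W x *v integral\<^sup>L M f) * norm e" by (rule norm_cauchy_schwarz)
      also have "\<dots> \<le> G x" using e G[OF f] by simp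
      finally show "integrable M f \<and> integral\<^sup>L M f \<bullet> (W x *v e) \<le> G x" using int[OF f] by blast
    qed
    then have "AE y in M. \<forall>e\<in>Basis. norm (T y *v (W x *v e)) \<le> G x"
      by (subst AE_ball_countable) (auto intro: countable_finite)
    then show ?case
      using sa_T
    proof eventually_elim
      case (elim y)
      have "op_norm (W x ** T y) \<le> (\<Sum>e\<in>Basis. norm (T y *v (W x *v e)))"
        by (intro op_norm_le_sum_Basis elim \<open>self_adjoint_mat (W x)\<close>)
      also have "\<dots> \<le> b * G x"
        unfolding b_def using elim(1) by (intro sum_bounded_above) auto
      finally show ?case .
    qed
  qed
  then have "AE y in M. AE x in M. op_norm (W x ** T y) \<le> b * G x"
    by (subst (asm) AE_commute) measurable
  then show ?thesis
  proof eventually_elim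
    case (elim y)
    have "(\<integral>\<^sup>+x. ennreal (op_norm (W x ** T y) powr q) \<partial>M)
        \<le> (\<integral>\<^sup>+x. ennreal (b powr q) * ennreal (G x powr q) \<partial>M)"
    proof (rule nn_integral_mono_AE)
      show "AE x in M. ennreal (op_norm (W x ** T y) powr q) \<le> ennreal (b powr q) * ennreal (G x powr q)"
        using elim
      proof eventually_elim
        case (elim x)
        then have "op_norm (W x ** T y) powr q \<le> (b * G x) powr q"
          using q by (intro powr_mono2) auto
        then show ?case using b G0 by (simp add: powr_mult ennreal_mult[symmetric] ennreal_leI)
      qed
    qed
    also have "\<dots> = ennreal (b powr q) * (\<integral>\<^sup>+x. ennreal (G x powr q) \<partial>M)"
      by (rule nn_integral_cmult) measurable
    also have "\<dots> \<le> ennreal (b powr q) * ennreal ((2 * real CARD('n)) powr q * real CARD('n) * K powr q)"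
      using GK by (rule mult_left_mono) simp
    finally show ?case by (simp add: ennreal_mult b_def mult_ac)
  qed
qed

end

section \<open>Cubes and matrix weights\<close>

lemma cube_props:
  fixes Q :: "(real^'d) set"
  assumes "Q \<in> cubes"
  shows cube_lmeasurable: "Q \<in> lmeasurable" and cube_interior: "interior Q \<noteq> {}"
    and cube_vol_pos: "0 < vol Q"
proof -
  obtain a :: "real^'d" and l I where l: "0 < l"
    and I: "\<And>i. I i \<in> {{a $ i .. a $ i + l}, {a $ i ..< a $ i + l},
                   {a $ i <.. a $ i + l}, {a $ i <..< a $ i + l}}"
    and Q: "Q = {x. \<forall>i. x $ i \<in> I i}"
    using assms unfolding cubes_def by blast
  define b :: "real^'d" where "b = a + (\<chi> i. l)"
  have I_sub: "{a $ i <..< a $ i + l} \<subseteq> I i" "I i \<subseteq> {a $ i .. a $ i + l}" "I i \<in> sets borel" for i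
  proof -
    have "I i = {a $ i .. a $ i + l} \<or> I i = {a $ i ..< a $ i + l} \<or>
        I i = {a $ i <.. a $ i + l} \<or> I i = {a $ i <..< a $ i + l}"
      using I[of i] by simp
    then show "{a $ i <..< a $ i + l} \<subseteq> I i" "I i \<subseteq> {a $ i .. a $ i + l}" "I i \<in> sets borel"
      by (elim disjE; simp add: subset_eq)+
  qed
  have sub1: "box a b \<subseteq> Q"
  proof
    fix x assume "x \<in> box a b"
    then have "x $ i \<in> {a $ i <..< a $ i + l}" for i by (simp add: mem_box_cart b_def)
    then show "x \<in> Q" using I_sub(1) unfolding Q by blast
  qed
  have sub2: "Q \<subseteq> cbox a b"
  proof
    fix x assume "x \<in> Q"
    then have "x $ i \<in> {a $ i .. a $ i + l}" for i using I_sub(2)[of i] unfolding Q by blast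
    then show "x \<in> cbox a b" by (simp add: mem_box_cart b_def)
  qed
  have "Q = (\<Inter>i. (\<lambda>x. x $ i) -` I i \<inter> space lborel)" by (auto simp: Q)
  also have "\<dots> \<in> sets lborel"
  proof (intro sets.finite_INT)
    fix i
    have "(\<lambda>x::real^'d. x $ i) \<in> borel_measurable lborel"
      by (simp add: borel_measurable_continuous_onI continuous_on_component)
    then show "(\<lambda>x. x $ i) -` I i \<inter> space lborel \<in> sets lborel"
      using I_sub(3) by (rule measurable_sets)
  qed auto
  finally have "Q \<in> sets lebesgue" by (rule sets_completionI_sets)
  then show lm: "Q \<in> lmeasurable"
    using bounded_subset[OF bounded_cbox sub2] by (rule bounded_set_imp_lmeasurable[rotated])
  have "a + (\<chi> i. l / 2) \<in> box a b" using l by (simp add: mem_box_cart b_def)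
  then have ne: "box a b \<noteq> {}" by blast
  then show "interior Q \<noteq> {}" using interior_maximal[OF sub1 open_box] by blast
  have "\<not> negligible Q"
    using ne open_not_negligible[OF open_box ne] negligible_subset[OF _ sub1] by blast
  then have "measure lebesgue Q \<noteq> 0"
    using lm by (simp add: negligible_iff_measure)
  then show "0 < vol Q" by (simp add: zero_less_measure_iff)
qed

lemma cube_sets: "Q \<in> cubes \<Longrightarrow> Q \<in> sets lebesgue"
  using cube_lmeasurable by (rule fmeasurableD)

text \<open>The entries are limits of their integrable restrictions to balls.\<close>

lemma matrix_weight_measurable:
  fixes U :: "real^'d \<Rightarrow> complex^'n^'n"
  assumes "matrix_weight U"
  shows "U \<in> borel_measurable lebesgue"
proof -
  have ent: "(\<lambda>x. U x $ i $ j) \<in> borel_measurable lebesgue" for i j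
  proof (rule borel_measurable_LIMSEQ_metric)
    fix k :: nat
    have "set_integrable lebesgue (cball 0 (real k)) (\<lambda>x. U x $ i $ j)"
      using assms unfolding matrix_weight_def by auto
    then show "(\<lambda>x. indicator (cball 0 (real k)) x *\<^sub>R U x $ i $ j) \<in> borel_measurable lebesgue"
      unfolding set_integrable_def by (rule borel_measurable_integrable)
  next
    fix x :: "real^'d"
    obtain k0 :: nat where k0: "norm x \<le> real k0" using real_arch_simple by blast
    show "(\<lambda>k. indicator (cball 0 (real k)) x *\<^sub>R U x $ i $ j) \<longlonglongrightarrow> U x $ i $ j"
      using k0 by (intro tendsto_eventually eventually_sequentiallyI[of k0]) (auto simp: indicator_def)
  qed
  have "(\<lambda>x. U x \<bullet> B) \<in> borel_measurable lebesgue" if "B \<in> Basis" for B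
  proof -
    obtain i j u where "B = axis i (axis j u)" using \<open>B \<in> Basis\<close> by (auto simp: Basis_vec_def)
    then have "(\<lambda>x. U x \<bullet> B) = (\<lambda>x. U x $ i $ j \<bullet> u)" by (simp add: inner_axis)
    then show ?thesis using ent[of i j] by simp
  qed
  then show ?thesis by (subst borel_measurable_euclidean_space) auto
qed

lemma matrix_weight_pos_def: "matrix_weight U \<Longrightarrow> AE x in lebesgue. pos_def_mat (U x)"
  by (simp add: matrix_weight_def)

lemma matrix_weight_powr_measurable:
  "matrix_weight U \<Longrightarrow> (\<lambda>x. mat_powr (U x) r) \<in> borel_measurable lebesgue"
  by (intro borel_measurable_mat_powr matrix_weight_measurable matrix_weight_pos_def)

lemma AE_lebesgue_on:
  "Q \<in> sets lebesgue \<Longrightarrow> AE x in lebesgue. P x \<Longrightarrow> AE x in lebesgue_on Q. P x"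
  by (subst AE_restrict_space_iff) auto

lemma weight_pair_on_cube:
  fixes U V :: "real^'d \<Rightarrow> complex^'n^'n"
  assumes U: "matrix_weight U" and V: "matrix_weight V" and Q: "Q \<in> cubes"
  shows "matrix_weight_pair (lebesgue_on Q) (\<lambda>x. mat_powr (U x) (1 / q)) (\<lambda>x. mat_powr (U x) (- (1 / q)))
    (\<lambda>y. mat_powr (V y) (1 / p)) (\<lambda>y. mat_powr (V y) (- 1 / p))"
proof -
  note lm = cube_lmeasurable[OF Q] and s = cube_sets[OF Q]
  interpret finite_measure "lebesgue_on Q" by (rule finite_measure_lebesgue_on[OF lm])
  show ?thesis
  proof
    show "AE x in lebesgue_on Q. mat_powr (U x) (- (1 / q)) ** mat_powr (U x) (1 / q) = mat 1"
    proof (rule AE_lebesgue_on[OF s])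
      show "AE x in lebesgue. mat_powr (U x) (- (1 / q)) ** mat_powr (U x) (1 / q) = mat 1"
        using matrix_weight_pos_def[OF U]
      proof eventually_elim
        case (elim x)
        then show ?case using mat_powr_mult_minus[of "U x" "- (1 / q)"] by simp
      qed
    qed
    show "AE y in lebesgue_on Q. mat_powr (V y) (- 1 / p) ** mat_powr (V y) (1 / p) = mat 1"
    proof (rule AE_lebesgue_on[OF s])
      show "AE y in lebesgue. mat_powr (V y) (- 1 / p) ** mat_powr (V y) (1 / p) = mat 1"
        using matrix_weight_pos_def[OF V]
      proof eventually_elim
        case (elim y)
        then show ?case using mat_powr_mult_minus[of "V y" "- 1 / p"] by simp
      qed
    qed
    show "AE x in lebesgue_on Q. self_adjoint_mat (mat_powr (U x) (1 / q))"
      using matrix_weight_pos_def[OF U]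
      by (intro AE_lebesgue_on[OF s]) (auto elim: eventually_mono intro: self_adjoint_mat_powr)
    show "AE y in lebesgue_on Q. self_adjoint_mat (mat_powr (V y) (- 1 / p))"
      using matrix_weight_pos_def[OF V]
      by (intro AE_lebesgue_on[OF s]) (auto elim: eventually_mono intro: self_adjoint_mat_powr)
    show "emeasure (lebesgue_on Q) (space (lebesgue_on Q)) \<noteq> 0"
      using cube_vol_pos[OF Q] s by (auto simp: emeasure_restrict_space measure_def)
  qed (auto intro: measurable_restrict_space1 matrix_weight_powr_measurable[OF U] matrix_weight_powr_measurable[OF V])
qed

lemma avg_lebesgue_on:
  "Q \<in> sets lebesgue \<Longrightarrow> avg Q g = ennreal (1 / vol Q) * (\<integral>\<^sup>+x. g x \<partial>lebesgue_on Q)"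
  by (simp add: avg_def nn_integral_restrict_space)

lemma set_integrable_lebesgue_on:
  fixes f :: "real^'d \<Rightarrow> complex^'n"
  shows "Q \<in> sets lebesgue \<Longrightarrow> set_integrable lebesgue Q f \<longleftrightarrow> integrable (lebesgue_on Q) f"
  by (simp add: set_integrable_def integrable_restrict_space)

lemma set_integral_lebesgue_on:
  fixes f :: "real^'d \<Rightarrow> complex^'n"
  shows "Q \<in> sets lebesgue \<Longrightarrow> (LINT y:Q|lebesgue. f y) = integral\<^sup>L (lebesgue_on Q) f"
  by (simp add: set_lebesgue_integral_def integral_restrict_space)

lemma Lp_space_iff:
  "f \<in> Lp_space p V \<longleftrightarrow> f \<in> borel_measurable lebesgue \<and>
     (\<integral>\<^sup>+x. ennreal (norm (mat_powr (V x) (1 / p) *v f x) powr p) \<partial>lebesgue) < top"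
  by (auto simp: Lp_space_def Lp_norm_def less_top[symmetric])

section \<open>The averaging operators of families of cubes\<close>

lemma avg_op_outside: "x \<notin> Q \<Longrightarrow> avg_op \<alpha> Q f x = 0"
  by (simp add: avg_op_def)

lemma avg_op_inside:
  fixes f :: "real^'d \<Rightarrow> complex^'n"
  assumes Q: "Q \<in> cubes" and x: "x \<in> Q"
  shows "avg_op \<alpha> Q f x = (vol Q powr (\<alpha> / real CARD('d) - 1)) *\<^sub>R integral\<^sup>L (lebesgue_on Q) f"
  using x cube_vol_pos[OF Q]
  by (simp add: avg_op_def set_integral_lebesgue_on cube_sets[OF Q] powr_diff)

lemma avg_family_op_inside:
  fixes f :: "real^'d \<Rightarrow> complex^'n"
  assumes F: "disjoint_cubes F" and Q: "Q \<in> F" and x: "x \<in> Q"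
  shows "avg_family_op \<alpha> F f x = (vol Q powr (\<alpha> / real CARD('d) - 1)) *\<^sub>R integral\<^sup>L (lebesgue_on Q) f"
proof -
  have "avg_family_op \<alpha> F f x = avg_op \<alpha> Q f x"
  proof -
    have zero: "avg_op \<alpha> R f x = 0" if "R \<in> F - {Q}" for R
    proof -
      have "R \<inter> Q = {}" using that F Q by (auto simp: disjoint_cubes_def disjoint_def)
      then show ?thesis using x by (intro avg_op_outside) auto
    qed
    have "infsum (\<lambda>R. avg_op \<alpha> R f x) F = infsum (\<lambda>R. avg_op \<alpha> R f x) {Q}"
      by (rule infsum_cong_neutral) (use zero Q in auto)
    then show ?thesis by (simp add: avg_family_op_def)
  qed
  then show ?thesis using avg_op_inside[OF _ x] F Q by (auto simp: disjoint_cubes_def)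
qed

lemma avg_family_op_outside: "x \<notin> \<Union>F \<Longrightarrow> avg_family_op \<alpha> F f x = 0"
  unfolding avg_family_op_def by (rule infsum_0) (auto intro: avg_op_outside)

lemma countable_disjoint_cubes: "disjoint_cubes F \<Longrightarrow> countable F"
  by (rule countable_disjoint_nonempty_interior_subsets)
     (auto simp: disjoint_cubes_def disjoint_def pairwise_def disjnt_def dest: cube_interior)

text \<open>The function is constant on each of the countably many cubes and on the complement of their
  union.\<close>

lemma avg_family_op_measurable:
  fixes f :: "real^'d \<Rightarrow> complex^'n"
  assumes F: "disjoint_cubes F"
  shows "avg_family_op \<alpha> F f \<in> borel_measurable lebesgue"
proof (rule measurable_piecewise_restrict[of "insert (- \<Union>F) F"])
  have s: "Q \<in> sets lebesgue" if "Q \<in> F" for Q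
    using F that by (auto simp: disjoint_cubes_def intro: cube_sets)
  then have UF: "\<Union>F \<in> sets lebesgue"
    using countable_disjoint_cubes[OF F] by (intro sets.countable_Union) auto
  show "countable (insert (- \<Union>F) F)" using countable_disjoint_cubes[OF F] by simp
  show "\<Omega> \<inter> space lebesgue \<in> sets lebesgue" if "\<Omega> \<in> insert (- \<Union>F) F" for \<Omega>
    using that s UF by (auto simp: Compl_in_sets_lebesgue)
  show "space lebesgue \<subseteq> \<Union>(insert (- \<Union>F) F)" by auto
  show "avg_family_op \<alpha> F f \<in> borel_measurable (lebesgue_on \<Omega>)" if "\<Omega> \<in> insert (- \<Union>F) F" for \<Omega>
  proof -
    have "\<exists>c. \<forall>x\<in>\<Omega>. avg_family_op \<alpha> F f x = c"
    proof (cases "\<Omega> \<in> F")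
      case True
      then show ?thesis using avg_family_op_inside[OF F] by blast
    next
      case False
      then have "\<Omega> = - \<Union>F" using that by blast
      then show ?thesis by (intro exI[of _ 0]) (auto intro: avg_family_op_outside)
    qed
    then obtain c where "\<And>x. x \<in> \<Omega> \<Longrightarrow> avg_family_op \<alpha> F f x = c" by blast
    then show ?thesis by (subst measurable_cong[of _ _ "\<lambda>_. c"]) auto
  qed
qed

lemma avg_family_op_energy_on_cube:
  fixes f :: "real^'d \<Rightarrow> complex^'n"
  assumes F: "disjoint_cubes F" and Q: "Q \<in> F" and U: "matrix_weight U"
  shows "(\<integral>\<^sup>+x\<in>Q. ennreal (norm (mat_powr (U x) r *v avg_family_op \<alpha> F f x) powr q) \<partial>lebesgue)
    = ennreal ((vol Q powr (\<alpha> / real CARD('d) - 1)) powr q) *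
      (\<integral>\<^sup>+x. ennreal (norm (mat_powr (U x) r *v integral\<^sup>L (lebesgue_on Q) f) powr q) \<partial>lebesgue_on Q)"
proof -
  have s: "Q \<in> sets lebesgue" using F Q by (auto simp: disjoint_cubes_def intro: cube_sets)
  have [measurable]: "(\<lambda>x. mat_powr (U x) r) \<in> borel_measurable (lebesgue_on Q)"
    by (intro measurable_restrict_space1 matrix_weight_powr_measurable U)
  have "(\<integral>\<^sup>+x\<in>Q. ennreal (norm (mat_powr (U x) r *v avg_family_op \<alpha> F f x) powr q) \<partial>lebesgue)
      = (\<integral>\<^sup>+x. ennreal (norm (mat_powr (U x) r *v avg_family_op \<alpha> F f x) powr q) \<partial>lebesgue_on Q)"
    using s by (simp add: nn_integral_restrict_space)
  also have "\<dots> = (\<integral>\<^sup>+x. ennreal ((vol Q powr (\<alpha> / real CARD('d) - 1)) powr q) *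
      ennreal (norm (mat_powr (U x) r *v integral\<^sup>L (lebesgue_on Q) f) powr q) \<partial>lebesgue_on Q)"
  proof (rule nn_integral_cong)
    fix x assume "x \<in> space (lebesgue_on Q)"
    then have "x \<in> Q" by simp
    then show "ennreal (norm (mat_powr (U x) r *v avg_family_op \<alpha> F f x) powr q)
      = ennreal ((vol Q powr (\<alpha> / real CARD('d) - 1)) powr q) *
        ennreal (norm (mat_powr (U x) r *v integral\<^sup>L (lebesgue_on Q) f) powr q)"
      by (simp add: avg_family_op_inside[OF F Q] linear_scale[OF matrix_vector_mul_linear]
          powr_mult ennreal_mult)
  qed
  also have "\<dots> = ennreal ((vol Q powr (\<alpha> / real CARD('d) - 1)) powr q) *
      (\<integral>\<^sup>+x. ennreal (norm (mat_powr (U x) r *v integral\<^sup>L (lebesgue_on Q) f) powr q) \<partial>lebesgue_on Q)"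
    by (rule nn_integral_cmult) measurable
  finally show ?thesis .
qed

text \<open>A finite family is padded with empty sets.\<close>

lemma disjoint_family_enumeration:
  assumes "countable F" "disjoint F"
  shows "\<exists>B :: nat \<Rightarrow> 'a set. disjoint_family B \<and> (\<forall>n. B n \<in> insert {} F) \<and> (\<Union>n. B n) = \<Union>F"
proof -
  define B where "B n = (if n \<in> to_nat_on F ` F then from_nat_into F n else {})" for n
  have B_in: "B (to_nat_on F Q) = Q" if "Q \<in> F" for Q
    using that assms(1) by (simp add: B_def)
  have B_cases: "B n = {} \<or> (\<exists>Q\<in>F. n = to_nat_on F Q \<and> B n = Q)" for n
    using B_in by (cases "n \<in> to_nat_on F ` F") (auto simp: B_def)
  have "disjoint_family B"
    unfolding disjoint_family_on_def
  proof (intro ballI impI)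
    fix m n :: nat assume "m \<noteq> n"
    show "B m \<inter> B n = {}"
    proof (cases "B m = {} \<or> B n = {}")
      case False
      then have "B m \<in> F" "m = to_nat_on F (B m)" "B n \<in> F" "n = to_nat_on F (B n)"
        using B_cases[of m] B_cases[of n] by auto
      moreover from this have "B m \<noteq> B n" using \<open>m \<noteq> n\<close> by metis
      ultimately show ?thesis using assms(2) by (intro disjointD)
    qed auto
  qed
  moreover have "B n \<in> insert {} F" for n using B_cases[of n] by auto
  moreover have "(\<Union>n. B n) = \<Union>F" using B_cases B_in by blast
  ultimately show ?thesis by (intro exI[of _ B]) blast
qed

text \<open>The local estimates are summed over the cubes. On the right this uses \<open>q / p \<ge> 1\<close>, which
  bounds the sum of the powers of the local norms by the power of their sum.\<close>

lemma avg_family_op_bounded_of_cubes: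
  fixes U V :: "real^'d \<Rightarrow> complex^'n^'n"
  assumes p: "1 \<le> p" and pq: "p \<le> q" and F: "disjoint_cubes F"
    and U: "matrix_weight U" and V: "matrix_weight V" and A: "A < top"
    and int: "\<And>f Q. f \<in> Lp_space p V \<Longrightarrow> Q \<in> F \<Longrightarrow> set_integrable lebesgue Q f"
    and bound: "\<And>f Q. f \<in> Lp_space p V \<Longrightarrow> Q \<in> F \<Longrightarrow>
      (\<integral>\<^sup>+x\<in>Q. ennreal (norm (mat_powr (U x) (1 / q) *v avg_family_op \<alpha> F f x) powr q) \<partial>lebesgue)
      \<le> ennreal_powr A q * ennreal_powr
        (\<integral>\<^sup>+x\<in>Q. ennreal (norm (mat_powr (V x) (1 / p) *v f x) powr p) \<partial>lebesgue) (q / p)"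
  shows "avg_family_op_bounded \<alpha> p q U V F A"
  unfolding avg_family_op_bounded_def
proof (intro ballI conjI)
  fix f assume f: "f \<in> Lp_space p V"
  show "set_integrable lebesgue Q f" if "Q \<in> F" for Q using int f that .
  have q: "1 \<le> q" using p pq by simp
  define g where "g = avg_family_op \<alpha> F f"
  have gm[measurable]: "g \<in> borel_measurable lebesgue"
    unfolding g_def by (rule avg_family_op_measurable[OF F])
  have [measurable]: "f \<in> borel_measurable lebesgue" using f by (simp add: Lp_space_iff)
  note [measurable] = matrix_weight_powr_measurable[OF U] matrix_weight_powr_measurable[OF V]
  define u where "u x = ennreal (norm (mat_powr (U x) (1 / q) *v g x) powr q)" for x
  define v where "v x = ennreal (norm (mat_powr (V x) (1 / p) *v f x) powr p)" for x
  have um[measurable]: "u \<in> borel_measurable lebesgue" unfolding u_def by measurable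
  have vm[measurable]: "v \<in> borel_measurable lebesgue" unfolding v_def by measurable
  have disj: "disjoint F" using F by (simp add: disjoint_cubes_def)
  obtain B :: "nat \<Rightarrow> (real^'d) set" where B: "disjoint_family B" "\<forall>n. B n \<in> insert {} F" "(\<Union>n. B n) = \<Union>F"
    using disjoint_family_enumeration[OF countable_disjoint_cubes[OF F] disj] by blast
  have Bs: "B n \<in> sets lebesgue" for n
    using B(2)[rule_format, of n] F by (auto simp: disjoint_cubes_def intro: cube_sets)
  have "(\<integral>\<^sup>+x. u x \<partial>lebesgue) = (\<integral>\<^sup>+x\<in>(\<Union>n. B n). u x \<partial>lebesgue)"
  proof (rule nn_integral_cong)
    fix x
    show "u x = u x * indicator (\<Union>n. B n) x"
      unfolding B(3) u_def g_def using avg_family_op_outside[of x F \<alpha> f]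
      by (cases "x \<in> \<Union>F") (simp_all add: indicator_def del: Union_iff)
  qed
  also have "\<dots> = (\<Sum>n. \<integral>\<^sup>+x\<in>B n. u x \<partial>lebesgue)"
    by (rule nn_integral_disjoint_family[OF um Bs B(1)])
  also have "\<dots> \<le> (\<Sum>n. ennreal_powr A q * ennreal_powr (\<integral>\<^sup>+x\<in>B n. v x \<partial>lebesgue) (q / p))"
  proof (intro suminf_le summableI)
    fix n
    show "(\<integral>\<^sup>+x\<in>B n. u x \<partial>lebesgue) \<le> ennreal_powr A q * ennreal_powr (\<integral>\<^sup>+x\<in>B n. v x \<partial>lebesgue) (q / p)"
      using B(2)[rule_format, of n] bound[OF f] unfolding u_def v_def g_def by auto
  qed
  also have "\<dots> = ennreal_powr A q * (\<Sum>n. ennreal_powr (\<integral>\<^sup>+x\<in>B n. v x \<partial>lebesgue) (q / p))"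
    by simp
  also have "\<dots> \<le> ennreal_powr A q * ennreal_powr (\<Sum>n. \<integral>\<^sup>+x\<in>B n. v x \<partial>lebesgue) (q / p)"
    using p pq by (intro mult_left_mono suminf_ennreal_powr_le) auto
  also have "(\<Sum>n. \<integral>\<^sup>+x\<in>B n. v x \<partial>lebesgue) = (\<integral>\<^sup>+x\<in>(\<Union>n. B n). v x \<partial>lebesgue)"
    by (rule nn_integral_disjoint_family[OF vm Bs B(1), symmetric])
  also have "ennreal_powr A q * ennreal_powr \<dots> (q / p) \<le> ennreal_powr A q * ennreal_powr (\<integral>\<^sup>+x. v x \<partial>lebesgue) (q / p)"
    using p q by (intro mult_left_mono ennreal_powr_mono nn_integral_mono) (auto simp: indicator_def)
  finally have "(\<integral>\<^sup>+x. u x \<partial>lebesgue) \<le> ennreal_powr A q * ennreal_powr (\<integral>\<^sup>+x. v x \<partial>lebesgue) (q / p)" .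
  also have "\<dots> = ennreal_powr (A * Lp_norm p V f) q"
    using p by (simp add: Lp_norm_def v_def ennreal_powr_mult ennreal_powr_powr)
  finally show le: "Lp_norm q U (avg_family_op \<alpha> F f) \<le> A * Lp_norm p V f"
    using q by (simp add: ennreal_powr_inverse_le_iff Lp_norm_def[of q] u_def g_def)
  have "A * Lp_norm p V f < top"
    using A f by (simp add: Lp_space_def ennreal_mult_less_top)
  then show "avg_family_op \<alpha> F f \<in> Lp_space q U"
    using gm le by (simp add: Lp_space_def g_def)
qed

section \<open>Equivalence of the two-weight condition and the uniform bounds\<close>

text \<open>The two averages contribute \<open>|Q|\<close> to the power \<open>-1/q - 1/p'\<close>, which combines with the outer
  factor to the factor \<open>|Q|\<^bsup>\<alpha>/d-1\<^esup>\<close> of the averaging operator.\<close>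

lemma A_char_eq:
  fixes U V :: "real^'d \<Rightarrow> complex^'n^'n"
  assumes p: "1 < p" and q: "1 \<le> q" and U: "matrix_weight U" and V: "matrix_weight V"
  shows "A_char \<alpha> p q U V = (SUP Q\<in>cubes. ennreal (vol Q powr (\<alpha> / real CARD('d) - 1)) *
    ennreal_powr (\<integral>\<^sup>+x. ennreal_powr (\<integral>\<^sup>+y. ennreal
      (op_norm (mat_powr (U x) (1/q) ** mat_powr (V y) (-1/p)) powr conj_exp p) \<partial>lebesgue_on Q)
      (q / conj_exp p) \<partial>lebesgue_on Q) (1/q))"
proof -
  define p' where "p' = conj_exp p"
  note cp = conj_exp_props[OF p, folded p'_def]
  have cube: "ennreal (vol Q powr (\<alpha> / real CARD('d) + 1/q - 1/p)) *
      ennreal_powr (avg Q (\<lambda>x. ennreal_powr (avg Q (\<lambda>y. ennreal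
        (op_norm (mat_powr (U x) (1/q) ** mat_powr (V y) (-1/p)) powr p'))) (q / p'))) (1/q)
    = ennreal (vol Q powr (\<alpha> / real CARD('d) - 1)) *
      ennreal_powr (\<integral>\<^sup>+x. ennreal_powr (\<integral>\<^sup>+y. ennreal
        (op_norm (mat_powr (U x) (1/q) ** mat_powr (V y) (-1/p)) powr p') \<partial>lebesgue_on Q)
        (q / p') \<partial>lebesgue_on Q) (1/q)" if Q: "Q \<in> cubes" for Q :: "(real^'d) set"
  proof -
    interpret P: matrix_weight_pair "lebesgue_on Q" "\<lambda>x. mat_powr (U x) (1 / q)" "\<lambda>x. mat_powr (U x) (- (1 / q))"
      "\<lambda>y. mat_powr (V y) (1 / p)" "\<lambda>y. mat_powr (V y) (- 1 / p)"
      by (rule weight_pair_on_cube[OF U V Q])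
    note [measurable] = P.meas
    define J where "J x = (\<integral>\<^sup>+y. ennreal
        (op_norm (mat_powr (U x) (1/q) ** mat_powr (V y) (-1/p)) powr p') \<partial>lebesgue_on Q)" for x
    have [measurable]: "J \<in> borel_measurable (lebesgue_on Q)" unfolding J_def by measurable
    define v where "v = vol Q"
    have v: "0 < v" using cube_vol_pos[OF Q] by (simp add: v_def)
    note avg = avg_lebesgue_on[OF cube_sets[OF Q], folded v_def]
    have "avg Q (\<lambda>x. ennreal_powr (avg Q (\<lambda>y. ennreal
        (op_norm (mat_powr (U x) (1/q) ** mat_powr (V y) (-1/p)) powr p'))) (q / p'))
        = ennreal (1 / v) * (\<integral>\<^sup>+x. ennreal ((1 / v) powr (q / p')) * ennreal_powr (J x) (q / p') \<partial>lebesgue_on Q)"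
      unfolding avg J_def[symmetric] using v by (simp add: ennreal_powr_mult ennreal_powr_ennreal)
    also have "\<dots> = ennreal (1 / v) * (ennreal ((1 / v) powr (q / p')) * (\<integral>\<^sup>+x. ennreal_powr (J x) (q / p') \<partial>lebesgue_on Q))"
      by (subst nn_integral_cmult) measurable
    finally have eq: "avg Q (\<lambda>x. ennreal_powr (avg Q (\<lambda>y. ennreal
        (op_norm (mat_powr (U x) (1/q) ** mat_powr (V y) (-1/p)) powr p'))) (q / p'))
        = ennreal (1 / v) * (ennreal ((1 / v) powr (q / p')) * (\<integral>\<^sup>+x. ennreal_powr (J x) (q / p') \<partial>lebesgue_on Q))" .
    have c: "v powr (\<alpha> / real CARD('d) + 1/q - 1/p) * ((1 / v) powr (1 / q) * ((1 / v) powr (q / p')) powr (1 / q))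
        = v powr (\<alpha> / real CARD('d) - 1)"
    proof -
      have e1: "(1 / v) powr (1 / q) = v powr (- 1 / q)"
        using v by (simp add: powr_divide powr_minus_divide)
      have "((1 / v) powr (q / p')) powr (1 / q) = (1 / v) powr (1 / p')"
        using q by (simp add: powr_powr)
      then have e2: "((1 / v) powr (q / p')) powr (1 / q) = v powr (- 1 / p')"
        using v by (simp add: powr_divide powr_minus_divide)
      have "(\<alpha> / real CARD('d) + 1/q - 1/p) + (- 1 / q + (- 1 / p')) = \<alpha> / real CARD('d) - (1 / p + 1 / p')"
        by simp
      then have "(\<alpha> / real CARD('d) + 1/q - 1/p) + (- 1 / q + (- 1 / p')) = \<alpha> / real CARD('d) - 1"
        by (simp only: cp)
      then show ?thesis unfolding e1 e2 powr_add[symmetric] by simp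
    qed
    have "ennreal (v powr (\<alpha> / real CARD('d) + 1/q - 1/p)) * ennreal_powr (ennreal (1 / v) *
        (ennreal ((1 / v) powr (q / p')) * (\<integral>\<^sup>+x. ennreal_powr (J x) (q / p') \<partial>lebesgue_on Q))) (1 / q)
      = ennreal (v powr (\<alpha> / real CARD('d) - 1)) * ennreal_powr (\<integral>\<^sup>+x. ennreal_powr (J x) (q / p') \<partial>lebesgue_on Q) (1 / q)"
      unfolding c[symmetric] using v by (simp add: ennreal_powr_mult ennreal_powr_ennreal ennreal_mult mult.assoc)
    then show ?thesis unfolding eq J_def v_def .
  qed
  have "p \<noteq> 1" using p by simp
  then show ?thesis
    unfolding A_char_def by (simp only: if_False) (intro SUP_cong refl cube[unfolded p'_def])
qed

text \<open>On a single cube the kernel estimates apply, and the factor \<open>|Q|\<^bsup>\<alpha>/d-1\<^esup>\<close> turns the norm of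
  the kernel into the term of the characteristic that belongs to this cube.\<close>

lemma cube_averages_le_A_char:
  fixes U V :: "real^'d \<Rightarrow> complex^'n^'n"
  assumes p: "1 \<le> p" and q: "1 \<le> q" and U: "matrix_weight U" and V: "matrix_weight V"
    and Q: "Q \<in> cubes" and f: "f \<in> Lp_space p V" and A: "A_char \<alpha> p q U V < top"
  shows "set_integrable lebesgue Q f" (is ?int)
    and "ennreal ((vol Q powr (\<alpha> / real CARD('d) - 1)) powr q) *
      (\<integral>\<^sup>+x. ennreal (norm (mat_powr (U x) (1/q) *v integral\<^sup>L (lebesgue_on Q) f) powr q) \<partial>lebesgue_on Q)
      \<le> ennreal_powr (A_char \<alpha> p q U V) q * ennreal_powr
        (\<integral>\<^sup>+x\<in>Q. ennreal (norm (mat_powr (V x) (1 / p) *v f x) powr p) \<partial>lebesgue) (q / p)" (is ?bound)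
proof -
  define v where "v = vol Q"
  have v: "0 < v" using cube_vol_pos[OF Q] by (simp add: v_def)
  define c where "c = v powr (\<alpha> / real CARD('d) - 1)"
  have c: "0 < c" using v by (simp add: c_def)
  note s = cube_sets[OF Q]
  interpret P: matrix_weight_pair "lebesgue_on Q" "\<lambda>x. mat_powr (U x) (1 / q)" "\<lambda>x. mat_powr (U x) (- (1 / q))"
      "\<lambda>y. mat_powr (V y) (1 / p)" "\<lambda>y. mat_powr (V y) (- 1 / p)"
    by (rule weight_pair_on_cube[OF U V Q])
  note [measurable] = P.meas
  have fm: "f \<in> borel_measurable (lebesgue_on Q)"
    using f by (intro measurable_restrict_space1) (simp add: Lp_space_iff)
  have en: "P.energy p f = (\<integral>\<^sup>+x\<in>Q. ennreal (norm (mat_powr (V x) (1 / p) *v f x) powr p) \<partial>lebesgue)"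
    using s by (simp add: P.energy_def nn_integral_restrict_space)
  have "P.energy p f \<le> (\<integral>\<^sup>+x. ennreal (norm (mat_powr (V x) (1 / p) *v f x) powr p) \<partial>lebesgue)"
    unfolding en by (intro nn_integral_mono) (auto simp: indicator_def)
  also have "\<dots> < top" using f by (simp add: Lp_space_iff)
  finally have en_fin: "P.energy p f < top" .
  have key: "ennreal (c powr q) * P.kernel_integral q f
      \<le> ennreal_powr (A_char \<alpha> p q U V) q * ennreal_powr (P.energy p f) (q / p)"
  proof (cases "p = 1")
    case False
    then have p1: "1 < p" using p by simp
    define J where "J = (\<integral>\<^sup>+x. ennreal_powr (\<integral>\<^sup>+y. ennreal
      (op_norm (mat_powr (U x) (1/q) ** mat_powr (V y) (-1/p)) powr conj_exp p) \<partial>lebesgue_on Q)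
      (q / conj_exp p) \<partial>lebesgue_on Q)"
    have "ennreal c * ennreal_powr J (1/q) \<le> A_char \<alpha> p q U V"
      unfolding A_char_eq[OF p1 q U V] c_def v_def J_def by (rule SUP_upper[OF Q])
    then have "ennreal_powr (ennreal c * ennreal_powr J (1/q)) q \<le> ennreal_powr (A_char \<alpha> p q U V) q"
      using q by (intro ennreal_powr_mono) auto
    then have cJ: "ennreal (c powr q) * J \<le> ennreal_powr (A_char \<alpha> p q U V) q"
      using c q by (simp add: ennreal_powr_mult ennreal_powr_powr ennreal_powr_ennreal)
    have "ennreal (c powr q) * P.kernel_integral q f \<le> ennreal (c powr q) * (J * ennreal_powr (P.energy p f) (q / p))"
      unfolding J_def using q by (intro mult_left_mono P.kernel_integral_le[OF fm p1]) auto
    also have "\<dots> \<le> ennreal_powr (A_char \<alpha> p q U V) q * ennreal_powr (P.energy p f) (q / p)"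
      using cJ by (simp add: mult_right_mono flip: mult.assoc)
    finally show ?thesis .
  next
    case True
    define I where "I y = (\<integral>\<^sup>+x. ennreal
      (op_norm (mat_powr (U x) (1/q) ** mat_powr (V y) (-1/p)) powr q) \<partial>lebesgue_on Q)" for y
    have [measurable]: "I \<in> borel_measurable (lebesgue_on Q)" unfolding I_def by measurable
    define X where "X = esssup (lebesgue_on Q) (\<lambda>y. ennreal_powr (ennreal (1 / v) * I y) (1 / q))"
    have "ennreal (v powr (\<alpha> / real CARD('d) + 1/q - 1)) * X \<le> A_char \<alpha> p q U V"
      unfolding A_char_def if_P[OF True] X_def I_def v_def
      using SUP_upper[OF Q, of "\<lambda>Q. ennreal (vol Q powr (\<alpha> / real CARD('d) + 1/q - 1)) *
         esssup (lebesgue_on Q) (\<lambda>y. ennreal_powr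
             (avg Q (\<lambda>x. ennreal (op_norm (mat_powr (U x) (1/q) ** mat_powr (V y) (-1)) powr q))) (1/q))"] True
      by (simp add: avg_lebesgue_on[OF s])
    then have "ennreal_powr (ennreal (v powr (\<alpha> / real CARD('d) + 1/q - 1)) * X) q \<le> ennreal_powr (A_char \<alpha> p q U V) q"
      using q by (intro ennreal_powr_mono) auto
    moreover have "(v powr (\<alpha> / real CARD('d) + 1/q - 1)) powr q = c powr q * v"
    proof -
      have "(v powr (\<alpha> / real CARD('d) + 1/q - 1)) powr q = v powr ((\<alpha> / real CARD('d) - 1) * q + 1)"
        using q by (simp add: powr_powr algebra_simps)
      also have "\<dots> = c powr q * v" using v by (simp add: powr_add c_def powr_powr)
      finally show ?thesis .
    qed
    ultimately have cX: "ennreal (c powr q) * (ennreal v * ennreal_powr X q) \<le> ennreal_powr (A_char \<alpha> p q U V) q"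
      using v c by (simp add: ennreal_powr_mult ennreal_powr_ennreal ennreal_mult mult.assoc)
    have Y: "AE y in lebesgue_on Q. I y \<le> ennreal v * ennreal_powr X q"
      using esssup_AE[of "\<lambda>y. ennreal_powr (ennreal (1 / v) * I y) (1 / q)" "lebesgue_on Q", folded X_def]
    proof eventually_elim
      case (elim y)
      then have le: "ennreal (1 / v) * I y \<le> ennreal_powr X q"
        using q by (simp add: ennreal_powr_inverse_le_iff)
      have "I y = ennreal v * (ennreal (1 / v) * I y)"
        using v by (simp add: mult.assoc[symmetric] ennreal_mult[symmetric])
      also have "\<dots> \<le> ennreal v * ennreal_powr X q" using le by (rule mult_left_mono) simp
      finally show ?case .
    qed
    have "P.kernel_integral q f \<le> (ennreal v * ennreal_powr X q) * ennreal_powr (P.energy 1 f) q"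
      using Y unfolding I_def by (rule P.kernel_integral_le_1[OF fm q])
    then have "ennreal (c powr q) * P.kernel_integral q f
        \<le> ennreal (c powr q) * ((ennreal v * ennreal_powr X q) * ennreal_powr (P.energy 1 f) q)"
      by (rule mult_left_mono) simp
    also have "\<dots> \<le> ennreal_powr (A_char \<alpha> p q U V) q * ennreal_powr (P.energy 1 f) q"
      using mult_right_mono[OF cX, of "ennreal_powr (P.energy 1 f) q"] by (simp add: mult.assoc)
    finally show ?thesis by (simp add: True)
  qed
  have "P.kernel_integral q f < top"
  proof (rule ccontr)
    assume "\<not> P.kernel_integral q f < top"
    then have "P.kernel_integral q f = top" by (simp add: not_less top_unique)
    then have "ennreal_powr (A_char \<alpha> p q U V) q * ennreal_powr (P.energy p f) (q / p) = top"
      using key c by (simp add: ennreal_mult_top top_unique)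
    then show False using A en_fin by (auto simp: ennreal_mult_eq_top_iff)
  qed
  then have int: "integrable (lebesgue_on Q) f"
    by (rule P.integrable_of_kernel_integral[OF fm])
  then show ?int by (simp add: set_integrable_lebesgue_on[OF s])
  have "ennreal (c powr q) * (\<integral>\<^sup>+x. ennreal (norm (mat_powr (U x) (1/q) *v integral\<^sup>L (lebesgue_on Q) f) powr q) \<partial>lebesgue_on Q)
      \<le> ennreal (c powr q) * P.kernel_integral q f"
    using q by (intro mult_left_mono P.norm_average_le_kernel_integral int) auto
  also note key
  finally show ?bound unfolding en c_def v_def .
qed

text \<open>A function on the cube is extended by zero to an element of the domain space, and the
  operator of the family \<open>{Q}\<close> is applied to it.\<close>

lemma averages_le_of_family_bounded:
  fixes U V :: "real^'d \<Rightarrow> complex^'n^'n"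
  assumes p: "1 \<le> p" and q: "1 \<le> q" and U: "matrix_weight U" and V: "matrix_weight V"
    and Q: "Q \<in> cubes" and k: "0 \<le> k"
    and K: "avg_family_op_bounded \<alpha> p q U V {Q} (ennreal k)"
    and f: "f \<in> borel_measurable (lebesgue_on Q)"
    and le1: "(\<integral>\<^sup>+y. ennreal (norm (mat_powr (V y) (1 / p) *v f y) powr p) \<partial>lebesgue_on Q) \<le> 1"
  shows "integrable (lebesgue_on Q) f"
    and "(\<integral>\<^sup>+x. ennreal (norm (mat_powr (U x) (1/q) *v integral\<^sup>L (lebesgue_on Q) f) powr q) \<partial>lebesgue_on Q)
      \<le> ennreal ((k / vol Q powr (\<alpha> / real CARD('d) - 1)) powr q)"
proof -
  note s = cube_sets[OF Q]
  define c where "c = vol Q powr (\<alpha> / real CARD('d) - 1)"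
  have c: "0 < c" using cube_vol_pos[OF Q] by (simp add: c_def)
  have F: "disjoint_cubes {Q}" using Q by (simp add: disjoint_cubes_def)
  define g where "g x = indicator Q x *\<^sub>R f x" for x
  have gm: "g \<in> borel_measurable lebesgue"
    using f s unfolding g_def by (subst (asm) borel_measurable_restrict_space_iff) auto
  have gf: "g x = f x" if "x \<in> Q" for x using that by (simp add: g_def)
  have "(\<integral>\<^sup>+y. ennreal (norm (mat_powr (V y) (1 / p) *v g y) powr p) \<partial>lebesgue)
      = (\<integral>\<^sup>+y\<in>Q. ennreal (norm (mat_powr (V y) (1 / p) *v f y) powr p) \<partial>lebesgue)"
    by (intro nn_integral_cong) (auto simp: g_def indicator_def)
  also have "\<dots> \<le> 1" using le1 s by (simp add: nn_integral_restrict_space)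
  finally have en: "(\<integral>\<^sup>+y. ennreal (norm (mat_powr (V y) (1 / p) *v g y) powr p) \<partial>lebesgue) \<le> 1" .
  then have g: "g \<in> Lp_space p V"
    using gm by (auto simp: Lp_space_iff intro: le_less_trans)
  have "ennreal_powr (\<integral>\<^sup>+y. ennreal (norm (mat_powr (V y) (1 / p) *v g y) powr p) \<partial>lebesgue) (1 / p) \<le> ennreal_powr 1 (1 / p)"
    using en p by (intro ennreal_powr_mono) auto
  also have "ennreal_powr 1 (1 / p) = 1"
    using ennreal_powr_ennreal[of 1 "1 / p"] by simp
  finally have norm1: "Lp_norm p V g \<le> 1" by (simp add: Lp_norm_def)
  have "integrable (lebesgue_on Q) g"
    using K g s by (auto simp: avg_family_op_bounded_def set_integrable_lebesgue_on)
  moreover have "integrable (lebesgue_on Q) g \<longleftrightarrow> integrable (lebesgue_on Q) f"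
    by (rule Bochner_Integration.integrable_cong) (auto simp: gf)
  ultimately show "integrable (lebesgue_on Q) f" by simp
  have int_eq: "integral\<^sup>L (lebesgue_on Q) g = integral\<^sup>L (lebesgue_on Q) f"
    by (intro Bochner_Integration.integral_cong) (auto simp: gf)
  have "Lp_norm q U (avg_family_op \<alpha> {Q} g) \<le> ennreal k * Lp_norm p V g"
    using K g by (auto simp: avg_family_op_bounded_def)
  also have "\<dots> \<le> ennreal k * 1" using norm1 by (rule mult_left_mono) simp
  finally have whole: "(\<integral>\<^sup>+x. ennreal (norm (mat_powr (U x) (1 / q) *v avg_family_op \<alpha> {Q} g x) powr q) \<partial>lebesgue)
      \<le> ennreal (k powr q)"
    using q k by (simp add: Lp_norm_def ennreal_powr_inverse_le_iff ennreal_powr_ennreal)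
  have "(\<integral>\<^sup>+x\<in>Q. ennreal (norm (mat_powr (U x) (1 / q) *v avg_family_op \<alpha> {Q} g x) powr q) \<partial>lebesgue)
      \<le> (\<integral>\<^sup>+x. ennreal (norm (mat_powr (U x) (1 / q) *v avg_family_op \<alpha> {Q} g x) powr q) \<partial>lebesgue)"
    by (intro nn_integral_mono) (auto simp: indicator_def)
  also note whole
  finally have "(\<integral>\<^sup>+x\<in>Q. ennreal (norm (mat_powr (U x) (1 / q) *v avg_family_op \<alpha> {Q} g x) powr q) \<partial>lebesgue)
      \<le> ennreal (k powr q)" .
  then have le: "ennreal (c powr q) *
      (\<integral>\<^sup>+x. ennreal (norm (mat_powr (U x) (1/q) *v integral\<^sup>L (lebesgue_on Q) f) powr q) \<partial>lebesgue_on Q)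
      \<le> ennreal (k powr q)"
    by (simp add: avg_family_op_energy_on_cube[OF F _ U] int_eq c_def)
  define X where "X = (\<integral>\<^sup>+x. ennreal (norm (mat_powr (U x) (1/q) *v integral\<^sup>L (lebesgue_on Q) f) powr q) \<partial>lebesgue_on Q)"
  have "X = ennreal (1 / c powr q) * (ennreal (c powr q) * X)"
    using c by (simp add: mult.assoc[symmetric] ennreal_mult[symmetric])
  also have "\<dots> \<le> ennreal (1 / c powr q) * ennreal (k powr q)"
    using le unfolding X_def by (rule mult_left_mono) simp
  also have "\<dots> = ennreal ((k / c) powr q)"
    using k c by (simp add: ennreal_mult[symmetric] powr_divide)
  finally show "(\<integral>\<^sup>+x. ennreal (norm (mat_powr (U x) (1/q) *v integral\<^sup>L (lebesgue_on Q) f) powr q) \<partial>lebesgue_on Q)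
      \<le> ennreal ((k / vol Q powr (\<alpha> / real CARD('d) - 1)) powr q)"
    by (simp add: X_def c_def)
qed

text \<open>The kernel bound obtained on each cube involves, besides the operator norm, only a constant
  \<open>B\<close> determined by the dimension and the exponents, so the supremum over the cubes is finite.\<close>

lemma A_char_finite_of_family_bounded:
  fixes U V :: "real^'d \<Rightarrow> complex^'n^'n"
  assumes p: "1 \<le> p" and q: "1 \<le> q" and U: "matrix_weight U" and V: "matrix_weight V"
    and K: "\<And>F. disjoint_cubes F \<Longrightarrow> avg_family_op_bounded \<alpha> p q U V F K" "K < top"
  shows "A_char \<alpha> p q U V < top"
proof -
  obtain k where k: "K = ennreal k" "0 \<le> k" using K(2) by (cases K) auto
  have KQ: "avg_family_op_bounded \<alpha> p q U V {Q} (ennreal k)" if "Q \<in> cubes" for Q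
    using K(1)[of "{Q}"] that k by (simp add: disjoint_cubes_def)
  note avgs = averages_le_of_family_bounded[OF p q U V _ k(2) KQ]
  show ?thesis
  proof (cases "p = 1")
    case False
    then have p1: "1 < p" using p by simp
    define B where "B = (real DIM(complex^'n) powr conj_exp p * real DIM(complex^'n)) powr (q / conj_exp p)
          * ((2 * real CARD('n)) powr q * real CARD('n))"
    have B: "0 \<le> B" by (simp add: B_def)
    have "A_char \<alpha> p q U V \<le> ennreal (B powr (1 / q) * k)"
      unfolding A_char_eq[OF p1 q U V]
    proof (rule SUP_least)
      fix Q :: "(real^'d) set" assume Q: "Q \<in> cubes"
      define c where "c = vol Q powr (\<alpha> / real CARD('d) - 1)"
      have c: "0 < c" using cube_vol_pos[OF Q] by (simp add: c_def)
      interpret P: matrix_weight_pair "lebesgue_on Q" "\<lambda>x. mat_powr (U x) (1 / q)" "\<lambda>x. mat_powr (U x) (- (1 / q))"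
          "\<lambda>y. mat_powr (V y) (1 / p)" "\<lambda>y. mat_powr (V y) (- 1 / p)"
        by (rule weight_pair_on_cube[OF U V Q])
      have "(\<integral>\<^sup>+x. ennreal_powr (\<integral>\<^sup>+y. ennreal
          (op_norm (mat_powr (U x) (1/q) ** mat_powr (V y) (-1/p)) powr conj_exp p) \<partial>lebesgue_on Q)
          (q / conj_exp p) \<partial>lebesgue_on Q) \<le> ennreal (B * (k / c) powr q)" (is "?J \<le> _")
        unfolding B_def
      proof (rule P.kernel_le_of_averages_bounded[OF p1 q])
        show "0 \<le> k / c" using k c by simp
        show "integrable (lebesgue_on Q) f" if "f \<in> borel_measurable (lebesgue_on Q)" "P.energy p f \<le> 1" for f
          using avgs(1)[OF Q Q that(1)] that(2) by (simp add: P.energy_def)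
        show "(\<integral>\<^sup>+x. ennreal (norm (mat_powr (U x) (1/q) *v integral\<^sup>L (lebesgue_on Q) f) powr q) \<partial>lebesgue_on Q)
            \<le> ennreal ((k / c) powr q)"
          if "f \<in> borel_measurable (lebesgue_on Q)" "P.energy p f \<le> 1" for f
          using avgs(2)[OF Q Q that(1)] that(2) by (simp add: P.energy_def c_def)
      qed
      then have "ennreal_powr ?J (1 / q) \<le> ennreal_powr (ennreal (B * (k / c) powr q)) (1 / q)"
        using q by (intro ennreal_powr_mono) auto
      also have "\<dots> = ennreal (B powr (1 / q) * (k / c))"
        using B k c q by (subst ennreal_powr_ennreal) (auto simp: powr_mult powr_powr)
      finally have "ennreal c * ennreal_powr ?J (1 / q) \<le> ennreal c * ennreal (B powr (1 / q) * (k / c))"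
        by (rule mult_left_mono) simp
      also have "\<dots> = ennreal (B powr (1 / q) * k)"
        using c by (simp add: ennreal_mult'[symmetric])
      finally show "ennreal (vol Q powr (\<alpha> / real CARD('d) - 1)) * ennreal_powr ?J (1 / q) \<le> ennreal (B powr (1 / q) * k)"
        by (simp add: c_def)
    qed
    then show ?thesis by (rule le_less_trans) simp
  next
    case True
    define B where "B = real DIM(complex^'n) powr q * ((2 * real CARD('n)) powr q * real CARD('n))"
    have B: "0 \<le> B" by (simp add: B_def)
    have "A_char \<alpha> p q U V \<le> ennreal (B powr (1 / q) * k)"
      unfolding A_char_def if_P[OF True]
    proof (rule SUP_least)
      fix Q :: "(real^'d) set" assume Q: "Q \<in> cubes"
      define v where "v = vol Q"
      have v: "0 < v" using cube_vol_pos[OF Q] by (simp add: v_def)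
      define c where "c = v powr (\<alpha> / real CARD('d) - 1)"
      have c: "0 < c" using v by (simp add: c_def)
      interpret P: matrix_weight_pair "lebesgue_on Q" "\<lambda>x. mat_powr (U x) (1 / q)" "\<lambda>x. mat_powr (U x) (- (1 / q))"
          "\<lambda>y. mat_powr (V y) (1 / p)" "\<lambda>y. mat_powr (V y) (- 1 / p)"
        by (rule weight_pair_on_cube[OF U V Q])
      note [measurable] = P.meas
      define I where "I y = (\<integral>\<^sup>+x. ennreal
        (op_norm (mat_powr (U x) (1/q) ** mat_powr (V y) (-1/p)) powr q) \<partial>lebesgue_on Q)" for y
      have [measurable]: "I \<in> borel_measurable (lebesgue_on Q)" unfolding I_def by measurable
      have "AE y in lebesgue_on Q. I y \<le> ennreal (B * (k / c) powr q)"
        unfolding B_def I_def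
      proof (rule P.kernel_le_of_averages_bounded_1[OF q])
        show "0 \<le> k / c" using k c by simp
        show "integrable (lebesgue_on Q) f" if "f \<in> borel_measurable (lebesgue_on Q)" "P.energy 1 f \<le> 1" for f
          using avgs(1)[OF Q Q that(1)] that(2)[unfolded P.energy_def] True by simp
        show "(\<integral>\<^sup>+x. ennreal (norm (mat_powr (U x) (1/q) *v integral\<^sup>L (lebesgue_on Q) f) powr q) \<partial>lebesgue_on Q)
            \<le> ennreal ((k / c) powr q)"
          if "f \<in> borel_measurable (lebesgue_on Q)" "P.energy 1 f \<le> 1" for f
          using avgs(2)[OF Q Q that(1)] that(2)[unfolded P.energy_def] True by (simp add: c_def v_def)
      qed
      then have "AE y in lebesgue_on Q. ennreal_powr (ennreal (1 / v) * I y) (1 / q)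
          \<le> ennreal (v powr (- 1 / q) * (B powr (1 / q) * (k / c)))"
      proof eventually_elim
        case (elim y)
        then have "ennreal (1 / v) * I y \<le> ennreal (1 / v) * ennreal (B * (k / c) powr q)"
          by (rule mult_left_mono) simp
        also have "\<dots> = ennreal ((1 / v) * (B * (k / c) powr q))"
          using v by (intro ennreal_mult'[symmetric]) simp
        finally have "ennreal_powr (ennreal (1 / v) * I y) (1 / q)
            \<le> ennreal_powr (ennreal ((1 / v) * (B * (k / c) powr q))) (1 / q)"
          using q by (intro ennreal_powr_mono) auto
        also have "\<dots> = ennreal ((1 / v) powr (1 / q) * (B powr (1 / q) * (k / c)))"
          using B k c q v by (subst ennreal_powr_ennreal) (auto simp: powr_mult powr_powr powr_divide)
        also have "(1 / v) powr (1 / q) = v powr (- 1 / q)"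
          using v by (simp add: powr_divide powr_minus_divide)
        finally show ?case .
      qed
      then have "esssup (lebesgue_on Q) (\<lambda>y. ennreal_powr (ennreal (1 / v) * I y) (1 / q))
          \<le> ennreal (v powr (- 1 / q) * (B powr (1 / q) * (k / c)))"
        by (intro esssup_I) measurable
      then have "ennreal (v powr (\<alpha> / real CARD('d) + 1/q - 1)) *
          esssup (lebesgue_on Q) (\<lambda>y. ennreal_powr (ennreal (1 / v) * I y) (1 / q))
          \<le> ennreal (v powr (\<alpha> / real CARD('d) + 1/q - 1)) *
            ennreal (v powr (- 1 / q) * (B powr (1 / q) * (k / c)))"
        by (rule mult_left_mono) simp
      also have "\<dots> = ennreal (v powr (\<alpha> / real CARD('d) + 1/q - 1) *
            (v powr (- 1 / q) * (B powr (1 / q) * (k / c))))"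
        by (simp only: ennreal_mult' powr_ge_zero)
      also have "v powr (\<alpha> / real CARD('d) + 1/q - 1) * (v powr (- 1 / q) * (B powr (1 / q) * (k / c)))
          = B powr (1 / q) * k"
      proof -
        have "v powr (\<alpha> / real CARD('d) + 1/q - 1) * v powr (- 1 / q) = c"
          by (simp add: c_def powr_add[symmetric])
        then show ?thesis using c by (simp add: mult.assoc[symmetric])
      qed
      finally show "ennreal (vol Q powr (\<alpha> / real CARD('d) + 1/q - 1)) *
         esssup (lebesgue_on Q) (\<lambda>y. ennreal_powr
             (avg Q (\<lambda>x. ennreal (op_norm (mat_powr (U x) (1/q) ** mat_powr (V y) (-1)) powr q))) (1/q))
         \<le> ennreal (B powr (1 / q) * k)"
        using True by (simp add: avg_lebesgue_on[OF cube_sets[OF Q]] I_def v_def)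
    qed
    then show ?thesis by (rule le_less_trans) simp
  qed
qed

theorem theorem1p18:
  fixes \<alpha> p q :: real
  assumes "0 \<le> \<alpha>" "\<alpha> < real CARD('d::finite)"
    and "1 \<le> p" "p \<le> q"
    and "1/p - 1/q \<le> \<alpha> / real CARD('d)"
  shows "\<exists>C::real. 0 < C \<and>
    (\<forall>(U :: real^'d \<Rightarrow> complex^'n^'n) (V :: real^'d \<Rightarrow> complex^'n^'n).
      matrix_weight U \<longrightarrow> matrix_weight V \<longrightarrow>
        (A_char \<alpha> p q U V < \<infinity> \<longleftrightarrow>
          (\<exists>K::ennreal. K < \<infinity> \<and>
            (\<forall>F. disjoint_cubes F \<longrightarrow> avg_family_op_bounded \<alpha> p q U V F K))) \<and>
        (A_char \<alpha> p q U V < \<infinity> \<longrightarrow>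
          (\<forall>F. disjoint_cubes F \<longrightarrow>
            avg_family_op_bounded \<alpha> p q U V F (ennreal C * A_char \<alpha> p q U V))))"
proof -
  have q: "1 \<le> q" using assms by simp
  have bounded: "avg_family_op_bounded \<alpha> p q U V F (A_char \<alpha> p q U V)"
    if U: "matrix_weight U" and V: "matrix_weight V" and A: "A_char \<alpha> p q U V < top"
      and F: "disjoint_cubes F"
    for U V :: "real^'d \<Rightarrow> complex^'n^'n" and F
  proof (rule avg_family_op_bounded_of_cubes[OF assms(3,4) F U V A])
    fix f Q assume f: "f \<in> Lp_space p V" and QF: "Q \<in> F"
    then have Q: "Q \<in> cubes" using F by (auto simp: disjoint_cubes_def)
    show "set_integrable lebesgue Q f"
      by (rule cube_averages_le_A_char(1)[OF assms(3) q U V Q f A])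
    show "(\<integral>\<^sup>+x\<in>Q. ennreal (norm (mat_powr (U x) (1 / q) *v avg_family_op \<alpha> F f x) powr q) \<partial>lebesgue)
      \<le> ennreal_powr (A_char \<alpha> p q U V) q * ennreal_powr
        (\<integral>\<^sup>+x\<in>Q. ennreal (norm (mat_powr (V x) (1 / p) *v f x) powr p) \<partial>lebesgue) (q / p)"
      unfolding avg_family_op_energy_on_cube[OF F QF U]
      by (rule cube_averages_le_A_char(2)[OF assms(3) q U V Q f A])
  qed
  have finite: "A_char \<alpha> p q U V < top"
    if "matrix_weight U" "matrix_weight V" "K < top"
      and "\<forall>F. disjoint_cubes F \<longrightarrow> avg_family_op_bounded \<alpha> p q U V F K"
    for U V :: "real^'d \<Rightarrow> complex^'n^'n" and K
    using that by (intro A_char_finite_of_family_bounded[OF assms(3) q]) auto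
  show ?thesis
  proof (rule exI[of _ "1 :: real"], intro conjI allI impI iffI)
    fix U V :: "real^'d \<Rightarrow> complex^'n^'n"
    assume U: "matrix_weight U" and V: "matrix_weight V"
    show "\<exists>K<\<infinity>. \<forall>F. disjoint_cubes F \<longrightarrow> avg_family_op_bounded \<alpha> p q U V F K"
      if "A_char \<alpha> p q U V < \<infinity>"
      using bounded[OF U V] that by (intro exI[of _ "A_char \<alpha> p q U V"]) auto
    show "A_char \<alpha> p q U V < \<infinity>"
      if "\<exists>K<\<infinity>. \<forall>F. disjoint_cubes F \<longrightarrow> avg_family_op_bounded \<alpha> p q U V F K"
      using finite[OF U V] that by auto
    show "avg_family_op_bounded \<alpha> p q U V F (ennreal 1 * A_char \<alpha> p q U V)"
      if "A_char \<alpha> p q U V < \<infinity>" "disjoint_cubes F" for F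
      using bounded[OF U V] that by auto
  qed simp
qed

end
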